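(* Let $G=\langle x,y : x^{-1}yx=y^{-1}\rangle$ be the Klein bottle group, and let $\leq$ be the left-ordering on $G$ defined by: $x^n y^m\leq x^{n'}y^{m'}$ if and only if either $n<n'$, or $n=n'$ and $m\leq m'$ (for $n,m,n',m'\in\mathbb{Z}$). Then the structure $(G,\cdot,\leq)$ has dp-rank $2$.
   Context: In $G=\langle x,y : x^{-1}yx=y^{-1}\rangle$ every element can be uniquely written as $x^n y^m$ with $n,m\in\mathbb{Z}$, and $(x^n y^m)\cdot(x^{n'}y^{m'})=x^{n+n'}y^{m'+(-1)^{n'}m}$. Let $T$ be a complete first-order theory and $\pi(\overline{x})$ a partial type. An ict-pattern of depth $\kappa$ in $\pi(\overline{x})$ is a sequence of formulas $\langle\varphi_i(\overline{x};\overline{y}_i): i<\kappa\rangle$ together with an array of parameters $\{\overline{a}_{i,j}: i<\kappa, j<\omega\}$ from some model of $T$ such that for each $\eta:\kappa\to\omega$ the partial type $\pi(\overline{x})\cup\{\varphi_i(\overline{x};\overline{a}_{i,\eta(i)}): i<\kappa\}\cup\{\neg\varphi_i(\overline{x};\overline{a}_{i,j}): i<\kappa, j\neq\eta(i)\}$ is consistent. The dp-rank of $\pi(\overline{x})$ is the maximal $\kappa$ such that there is an ict-pattern of depth $\kappa$ in $\pi(\overline{x})$, if such a maximum exists. The dp-rank of $T$ is the dp-rank of $x=x$, where $x$ is a single variable; the dp-rank of a structure is the dp-rank of its complete theory. *)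

theory Defs
  imports "HOL-Algebra.Group" "HOL-Library.Infinite_Typeclass"
begin

section \<open>First-order logic\<close>

record ('f, 'r) signature =
  fun_arity :: "'f \<Rightarrow> nat"
  rel_arity :: "'r \<Rightarrow> nat"

datatype 'f trm = Var nat | Fn 'f "'f trm list"

datatype ('f, 'r) fm =
    Eq "'f trm" "'f trm"
  | Rl 'r "'f trm list"
  | Neg "('f, 'r) fm"
  | Conj "('f, 'r) fm" "('f, 'r) fm"
  | Exi nat "('f, 'r) fm"

fun wf_trm :: "('f, 'r) signature \<Rightarrow> 'f trm \<Rightarrow> bool" where
  "wf_trm L (Var k) \<longleftrightarrow> True"
| "wf_trm L (Fn g ts) \<longleftrightarrow> length ts = fun_arity L g \<and> (\<forall>t\<in>set ts. wf_trm L t)"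

fun wf_fm :: "('f, 'r) signature \<Rightarrow> ('f, 'r) fm \<Rightarrow> bool" where
  "wf_fm L (Eq s t) \<longleftrightarrow> wf_trm L s \<and> wf_trm L t"
| "wf_fm L (Rl r ts) \<longleftrightarrow> length ts = rel_arity L r \<and> (\<forall>t\<in>set ts. wf_trm L t)"
| "wf_fm L (Neg \<phi>) \<longleftrightarrow> wf_fm L \<phi>"
| "wf_fm L (Conj \<phi> \<psi>) \<longleftrightarrow> wf_fm L \<phi> \<and> wf_fm L \<psi>"
| "wf_fm L (Exi k \<phi>) \<longleftrightarrow> wf_fm L \<phi>"

fun fv_trm :: "'f trm \<Rightarrow> nat set" where
  "fv_trm (Var k) = {k}"
| "fv_trm (Fn g ts) = (\<Union>t\<in>set ts. fv_trm t)"

fun fv :: "('f, 'r) fm \<Rightarrow> nat set" where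
  "fv (Eq s t) = fv_trm s \<union> fv_trm t"
| "fv (Rl r ts) = (\<Union>t\<in>set ts. fv_trm t)"
| "fv (Neg \<phi>) = fv \<phi>"
| "fv (Conj \<phi> \<psi>) = fv \<phi> \<union> fv \<psi>"
| "fv (Exi k \<phi>) = fv \<phi> - {k}"

text \<open>The values of \<open>fun_int\<close> and \<open>rel_int\<close> on lists of the wrong length are irrelevant:
  well-formed formulas never refer to them.\<close>

record ('f, 'r, 'm) struct =
  univ :: "'m set"
  fun_int :: "'f \<Rightarrow> 'm list \<Rightarrow> 'm"
  rel_int :: "'r \<Rightarrow> 'm list \<Rightarrow> bool"

definition is_struct :: "('f, 'r) signature \<Rightarrow> ('f, 'r, 'm) struct \<Rightarrow> bool" where
  "is_struct L M \<longleftrightarrow> univ M \<noteq> {} \<and>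
     (\<forall>g as. length as = fun_arity L g \<and> set as \<subseteq> univ M \<longrightarrow> fun_int M g as \<in> univ M)"

fun eval_trm :: "('f, 'r, 'm) struct \<Rightarrow> (nat \<Rightarrow> 'm) \<Rightarrow> 'f trm \<Rightarrow> 'm" where
  "eval_trm M e (Var k) = e k"
| "eval_trm M e (Fn g ts) = fun_int M g (map (eval_trm M e) ts)"

fun sat :: "('f, 'r, 'm) struct \<Rightarrow> (nat \<Rightarrow> 'm) \<Rightarrow> ('f, 'r) fm \<Rightarrow> bool" where
  "sat M e (Eq s t) \<longleftrightarrow> eval_trm M e s = eval_trm M e t"
| "sat M e (Rl r ts) \<longleftrightarrow> rel_int M r (map (eval_trm M e) ts)"
| "sat M e (Neg \<phi>) \<longleftrightarrow> \<not> sat M e \<phi>"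
| "sat M e (Conj \<phi> \<psi>) \<longleftrightarrow> sat M e \<phi> \<and> sat M e \<psi>"
| "sat M e (Exi k \<phi>) \<longleftrightarrow> (\<exists>a\<in>univ M. sat M (e(k := a)) \<phi>)"

definition sentence :: "('f, 'r) signature \<Rightarrow> ('f, 'r) fm \<Rightarrow> bool" where
  "sentence L \<phi> \<longleftrightarrow> wf_fm L \<phi> \<and> fv \<phi> = {}"

definition models :: "('f, 'r, 'm) struct \<Rightarrow> ('f, 'r) fm set \<Rightarrow> bool" where
  "models M T \<longleftrightarrow> (\<forall>\<phi>\<in>T. \<forall>e. range e \<subseteq> univ M \<longrightarrow> sat M e \<phi>)"

definition complete_theory :: "('f, 'r) signature \<Rightarrow> ('f, 'r, 'm) struct \<Rightarrow> ('f, 'r) fm set" where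
  "complete_theory L M = {\<phi>. sentence L \<phi> \<and> models M {\<phi>}}"

definition elementary_embedding ::
  "('f, 'r) signature \<Rightarrow> ('f, 'r, 'm) struct \<Rightarrow> ('f, 'r, 'n) struct \<Rightarrow> ('m \<Rightarrow> 'n) \<Rightarrow> bool" where
  "elementary_embedding L M N h \<longleftrightarrow> h ` univ M \<subseteq> univ N \<and>
     (\<forall>\<phi> e. wf_fm L \<phi> \<longrightarrow> range e \<subseteq> univ M \<longrightarrow> (sat M e \<phi> \<longleftrightarrow> sat N (h \<circ> e) \<phi>))"

section \<open>Dp-rank\<close>

text \<open>The tuple \<open>x\<close> of object variables consists of the variables \<open>Var 0, \<dots>, Var (n - 1)\<close>; all other
  free variables of a formula are parameter variables. A pair \<open>(\<phi>, c)\<close> stands for the formula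
  \<open>\<phi>(x; c)\<close> in which each parameter variable \<open>Var k\<close> is replaced by the element \<open>c k\<close> of a
  structure (only the finitely many \<open>k\<close> with \<open>Var k\<close> free in \<open>\<phi>\<close> matter).

  A set of formulas with parameters from \<open>M\<close> is consistent if it is realized in an elementary
  extension of \<open>M\<close>. By the downward Loewenheim-Skolem theorem, for countable signatures and
  infinite \<open>'m\<close>, restricting to elementary extensions that live on the same type \<open>'m\<close> as \<open>M\<close>
  is no loss (extensions are given by embeddings, so \<open>univ M\<close> may be all of \<open>'m\<close>).\<close>

definition consistent ::
  "('f, 'r) signature \<Rightarrow> ('f, 'r, 'm) struct \<Rightarrow> nat \<Rightarrow> (('f, 'r) fm \<times> (nat \<Rightarrow> 'm)) set \<Rightarrow> bool" where
  "consistent L M n \<Sigma> \<longleftrightarrow>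
     (\<exists>(N :: ('f, 'r, 'm) struct) h b.
        is_struct L N \<and> elementary_embedding L M N h \<and> range b \<subseteq> univ N \<and>
        (\<forall>(\<phi>, c)\<in>\<Sigma>. sat N (\<lambda>k. if k < n then b k else h (c k)) \<phi>))"

text \<open>\<open>\<pi>\<close> is a partial type without parameters: a set of well-formed formulas whose free variables
  are among \<open>Var 0, \<dots>, Var (n - 1)\<close>.\<close>

definition ict_pattern ::
  "('f, 'r) signature \<Rightarrow> ('f, 'r, 'm) struct \<Rightarrow> nat \<Rightarrow> ('f, 'r) fm set \<Rightarrow> 'i set \<Rightarrow>
   ('i \<Rightarrow> ('f, 'r) fm) \<Rightarrow> ('i \<Rightarrow> nat \<Rightarrow> nat \<Rightarrow> 'm) \<Rightarrow> bool" where
  "ict_pattern L M n \<pi> I \<phi> a \<longleftrightarrow>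
     (\<forall>i\<in>I. wf_fm L (\<phi> i)) \<and>
     (\<forall>i\<in>I. \<forall>j. range (a i j) \<subseteq> univ M) \<and>
     (\<forall>\<eta> :: 'i \<Rightarrow> nat. consistent L M n
        ({(\<psi>, c) | \<psi> c. \<psi> \<in> \<pi> \<and> range c \<subseteq> univ M} \<union>
         {(\<phi> i, a i (\<eta> i)) | i. i \<in> I} \<union>
         {(Neg (\<phi> i), a i j) | i j. i \<in> I \<and> j \<noteq> \<eta> i}))"

text \<open>Depths are cardinals, represented as in the library by well-orders \<open>\<kappa>\<close> with \<open>Card_order \<kappa>\<close>.
  Models are structures on subsets of the type \<open>'m\<close>.\<close>

definition has_ict_pattern_of_depth ::
  "'m itself \<Rightarrow> ('f, 'r) signature \<Rightarrow> ('f, 'r) fm set \<Rightarrow> nat \<Rightarrow> ('f, 'r) fm set \<Rightarrow> 'i rel \<Rightarrow> bool" where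
  "has_ict_pattern_of_depth _ L T n \<pi> \<kappa> \<longleftrightarrow>
     (\<exists>(M :: ('f, 'r, 'm) struct) \<phi> a.
        is_struct L M \<and> models M T \<and> ict_pattern L M n \<pi> (Field \<kappa>) \<phi> a)"

text \<open>HOL cannot quantify over all sets or all cardinals at once, so the types \<open>'m\<close> (which models
  live on) and \<open>'j\<close> (which the competing cardinals live on) are parameters. Statements about
  dp-rank should be made for all \<open>'j\<close> and all infinite \<open>'m\<close>.\<close>

definition has_dp_rank ::
  "'m itself \<Rightarrow> 'j itself \<Rightarrow> ('f, 'r) signature \<Rightarrow> ('f, 'r) fm set \<Rightarrow> nat \<Rightarrow> ('f, 'r) fm set \<Rightarrow>
   'k rel \<Rightarrow> bool" where
  "has_dp_rank \<mu> _ L T n \<pi> \<kappa> \<longleftrightarrow>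
     Card_order \<kappa> \<and> has_ict_pattern_of_depth \<mu> L T n \<pi> \<kappa> \<and>
     (\<forall>\<nu> :: 'j rel. Card_order \<nu> \<longrightarrow> has_ict_pattern_of_depth \<mu> L T n \<pi> \<nu> \<longrightarrow> (\<nu>, \<kappa>) \<in> ordLeq)"

definition theory_has_dp_rank ::
  "'m itself \<Rightarrow> 'j itself \<Rightarrow> ('f, 'r) signature \<Rightarrow> ('f, 'r) fm set \<Rightarrow> 'k rel \<Rightarrow> bool" where
  "theory_has_dp_rank \<mu> \<iota> L T \<kappa> \<longleftrightarrow> has_dp_rank \<mu> \<iota> L T 1 {Eq (Var 0) (Var 0)} \<kappa>"

definition structure_has_dp_rank ::
  "'m itself \<Rightarrow> 'j itself \<Rightarrow> ('f, 'r) signature \<Rightarrow> ('f, 'r, 's) struct \<Rightarrow> 'k rel \<Rightarrow> bool" where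
  "structure_has_dp_rank \<mu> \<iota> L A \<kappa> \<longleftrightarrow> theory_has_dp_rank \<mu> \<iota> L (complete_theory L A) \<kappa>"

section \<open>Group presentations\<close>

text \<open>Letters are pairs: \<open>(g, True)\<close> is the generator \<open>g\<close> and \<open>(g, False)\<close> its formal inverse.
  A pair of words \<open>(l, r)\<close> in \<open>R\<close> is the relation \<open>l = r\<close>.\<close>

type_synonym 'a word = "('a \<times> bool) list"

inductive pres_eq :: "('a word \<times> 'a word) set \<Rightarrow> 'a word \<Rightarrow> 'a word \<Rightarrow> bool"
  for R where
  refl: "pres_eq R u u"
| sym: "pres_eq R u v \<Longrightarrow> pres_eq R v u"
| trans: "pres_eq R u v \<Longrightarrow> pres_eq R v w \<Longrightarrow> pres_eq R u w"
| cancel: "pres_eq R (u @ [(g, s), (g, \<not> s)] @ v) (u @ v)"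
| relation: "(l, r) \<in> R \<Longrightarrow> pres_eq R (u @ l @ v) (u @ r @ v)"

definition pres_class :: "('a word \<times> 'a word) set \<Rightarrow> 'a word \<Rightarrow> 'a word set" where
  "pres_class R u = {v. pres_eq R u v}"

definition presented_group :: "('a word \<times> 'a word) set \<Rightarrow> 'a word set monoid" where
  "presented_group R =
     \<lparr> carrier = range (pres_class R),
       mult = (\<lambda>A B. \<Union>u\<in>A. \<Union>v\<in>B. pres_class R (u @ v)),
       one = pres_class R [] \<rparr>"

section \<open>The ordered Klein bottle group\<close>

datatype gen = X | Y

definition klein_relations :: "(gen word \<times> gen word) set" where
  "klein_relations = {([(X, False), (Y, True), (X, True)], [(Y, False)])}"

definition klein_group :: "gen word set monoid" where
  "klein_group = presented_group klein_relations"

definition klein_x :: "gen word set" where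
  "klein_x = pres_class klein_relations [(X, True)]"

definition klein_y :: "gen word set" where
  "klein_y = pres_class klein_relations [(Y, True)]"

definition klein_nf :: "int \<Rightarrow> int \<Rightarrow> gen word set" where
  "klein_nf n m =
     (klein_x [^]\<^bsub>klein_group\<^esub> n) \<otimes>\<^bsub>klein_group\<^esub> (klein_y [^]\<^bsub>klein_group\<^esub> m)"

definition klein_le :: "gen word set \<Rightarrow> gen word set \<Rightarrow> bool" where
  "klein_le a b \<longleftrightarrow> (\<exists>n m n' m'. a = klein_nf n m \<and> b = klein_nf n' m' \<and>
     (n < n' \<or> n = n' \<and> m \<le> m'))"

datatype fun_sym = Mult
datatype rel_sym = Le

definition ordered_group_sig :: "(fun_sym, rel_sym) signature" where
  "ordered_group_sig = \<lparr> fun_arity = (\<lambda>_. 2), rel_arity = (\<lambda>_. 2) \<rparr>"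

definition ordered_group_struct ::
  "'g monoid \<Rightarrow> ('g \<Rightarrow> 'g \<Rightarrow> bool) \<Rightarrow> (fun_sym, rel_sym, 'g) struct" where
  "ordered_group_struct G leq =
     \<lparr> univ = carrier G,
       fun_int = (\<lambda>_ as. as ! 0 \<otimes>\<^bsub>G\<^esub> as ! 1),
       rel_int = (\<lambda>_ as. leq (as ! 0) (as ! 1)) \<rparr>"

end

theory Submission
  imports Defs "HOL-Library.Nat_Bijection"
begin

text \<open>In the coordinates \<open>(n, m)\<close> of \<open>x^n y^m\<close>, the structure is definable in two disjoint copies of Presburger
  arithmetic: the sign \<open>(-1)^n'\<close> in the multiplication only depends on a residue. Quantifier elimination
  takes place in each copy separately, so a formula \<open>\<phi>(x; b)\<close> only depends on the residues of the
  two coordinates of \<open>x\<close> modulo a fixed number and on their positions relative to boundedly many cuts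
  determined by \<open>b\<close>. Over \<open>K\<close> parameters there are hence only \<open>O(K^2)\<close> types, whereas an ict-pattern of
  depth 3 with \<open>K\<close> columns realizes \<open>K^3\<close>. As finite parts of a pattern are described by sentences, this
  rules out depth 3 in all models. A pattern of depth 2 singles out the coordinates of \<open>x^(2k) y^l\<close> by
  quantifier-free formulas.\<close>

section \<open>Finite parts of ict-patterns\<close>

text \<open>The obstacle is the sign: the exponent of \<open>y\<close> in a product is not linear,
  because it involves the parity of an exponent of \<open>x\<close>. That parity is a divisibility
  atom of the first sort, so it can guard a case split whose branches are linear in the second sort
  alone. Every atom thus speaks of a single sort, eliminating a variable leaves the atoms of the
  other sort untouched, and a quantifier over group elements becomes two integer quantifiers. The
  moduli and the cuts depend on the formula only; parameters enter merely through the values that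
  the cuts take. Hence the constant in the quadratic bound, and with it the number \<open>K\<close>
  of columns that refutes depth 3, is fixed before the parameters of a pattern are considered. This
  uniformity is what makes a finite part of the pattern sufficient.\<close>

primrec ren_trm :: "(nat \<Rightarrow> nat) \<Rightarrow> 'f trm \<Rightarrow> 'f trm" where
  "ren_trm f (Var k) = Var (f k)"
| "ren_trm f (Fn g ts) = Fn g (map (ren_trm f) ts)"

primrec ren_fm :: "(nat \<Rightarrow> nat) \<Rightarrow> ('f, 'r) fm \<Rightarrow> ('f, 'r) fm" where
  "ren_fm f (Eq s t) = Eq (ren_trm f s) (ren_trm f t)"
| "ren_fm f (Rl r ts) = Rl r (map (ren_trm f) ts)"
| "ren_fm f (Neg \<phi>) = Neg (ren_fm f \<phi>)"
| "ren_fm f (Conj \<phi> \<psi>) = Conj (ren_fm f \<phi>) (ren_fm f \<psi>)"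
| "ren_fm f (Exi k \<phi>) = Exi (f k) (ren_fm f \<phi>)"

lemma eval_ren_trm: "eval_trm M e (ren_trm f t) = eval_trm M (e \<circ> f) t"
  by (induction t) (auto intro!: arg_cong[where f = "fun_int M _"])

lemma wf_ren_trm: "wf_trm L t \<Longrightarrow> wf_trm L (ren_trm f t)"
  by (induction t) auto

text \<open>Bound variables are renamed too, so injectivity is what confines an update at
  \<open>f k\<close> to the variable \<open>k\<close> in the quantifier case.\<close>

lemma sat_ren_fm: "inj f \<Longrightarrow> sat M e (ren_fm f \<phi>) \<longleftrightarrow> sat M (e \<circ> f) \<phi>"
proof (induction \<phi> arbitrary: e)
  case (Rl r ts)
  have "map (eval_trm M e) (map (ren_trm f) ts) = map (eval_trm M (e \<circ> f)) ts"
    by (simp add: eval_ren_trm)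
  then show ?case
    by (simp only: ren_fm.simps sat.simps)
next
  case (Exi k \<phi>)
  then have "e(f k := a) \<circ> f = (e \<circ> f)(k := a)" for a
    by (auto simp: fun_eq_iff inj_eq)
  then show ?case
    using Exi.IH[OF Exi.prems] by (simp only: ren_fm.simps sat.simps)
qed (simp_all add: eval_ren_trm)

lemma wf_ren_fm: "wf_fm L \<phi> \<Longrightarrow> wf_fm L (ren_fm f \<phi>)"
  by (induction \<phi>) (auto simp: wf_ren_trm)

lemma finite_fv_trm: "finite (fv_trm t)"
  by (induction t) auto

lemma finite_fv: "finite (fv \<phi>)"
  by (induction \<phi>) (auto simp: finite_fv_trm)

lemma eval_trm_cong: "(\<And>k. k \<in> fv_trm t \<Longrightarrow> e k = e' k) \<Longrightarrow> eval_trm M e t = eval_trm M e' t"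
proof (induction t)
  case (Fn g ts)
  then have "map (eval_trm M e) ts = map (eval_trm M e') ts"
    by (intro map_cong HOL.refl) (auto intro!: Fn)
  then show ?case
    by (simp only: eval_trm.simps)
qed simp

lemma sat_cong: "(\<And>k. k \<in> fv \<phi> \<Longrightarrow> e k = e' k) \<Longrightarrow> sat M e \<phi> \<longleftrightarrow> sat M e' \<phi>"
proof (induction \<phi> arbitrary: e e')
  case (Eq s t)
  show ?case
    using Eq.prems eval_trm_cong[of s e e' M] eval_trm_cong[of t e e' M] by simp
next
  case (Rl r ts)
  then have "map (eval_trm M e) ts = map (eval_trm M e') ts"
    by (intro map_cong HOL.refl eval_trm_cong) auto
  then show ?case
    by (simp only: sat.simps)
next
  case (Neg \<phi>)
  show ?case
    using Neg.prems Neg.IH[of e e'] by simp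
next
  case (Conj \<phi> \<psi>)
  show ?case
    using Conj.prems Conj.IH(1)[of e e'] Conj.IH(2)[of e e'] by simp
next
  case (Exi k \<phi>)
  have "sat M (e(k := a)) \<phi> \<longleftrightarrow> sat M (e'(k := a)) \<phi>" for a
    by (rule Exi.IH) (use Exi.prems in simp)
  then show ?case
    by simp
qed

definition conjs :: "('f, 'r) fm list \<Rightarrow> ('f, 'r) fm" where
  "conjs \<phi>s = foldr Conj \<phi>s (Eq (Var 0) (Var 0))"

lemma sat_conjs: "sat M e (conjs \<phi>s) \<longleftrightarrow> (\<forall>\<phi>\<in>set \<phi>s. sat M e \<phi>)"
  unfolding conjs_def by (induction \<phi>s) auto

lemma wf_conjs: "(\<And>\<phi>. \<phi> \<in> set \<phi>s \<Longrightarrow> wf_fm L \<phi>) \<Longrightarrow> wf_fm L (conjs \<phi>s)"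
  unfolding conjs_def by (induction \<phi>s) auto

definition exis :: "nat list \<Rightarrow> ('f, 'r) fm \<Rightarrow> ('f, 'r) fm" where
  "exis ks \<phi> = foldr Exi ks \<phi>"

lemma wf_exis: "wf_fm L \<phi> \<Longrightarrow> wf_fm L (exis ks \<phi>)"
  unfolding exis_def by (induction ks) auto

lemma fv_exis: "fv (exis ks \<phi>) = fv \<phi> - set ks"
  unfolding exis_def by (induction ks) auto

lemma sat_exisI: "sat M e \<phi> \<Longrightarrow> range e \<subseteq> univ M \<Longrightarrow> sat M e (exis ks \<phi>)"
  unfolding exis_def
proof (induction ks)
  case (Cons k ks)
  then show ?case
    by (auto intro!: bexI[of _ "e k"])
qed auto

lemma sat_exisE:
  assumes "sat M e (exis ks \<phi>)" "range e \<subseteq> univ M"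
  shows "\<exists>e'. range e' \<subseteq> univ M \<and> sat M e' \<phi>"
  using assms unfolding exis_def
proof (induction ks arbitrary: e)
  case (Cons k ks)
  then obtain a where a: "a \<in> univ M" "sat M (e(k := a)) (foldr Exi ks \<phi>)"
    by auto
  have "range (e(k := a)) \<subseteq> univ M"
    using a Cons.prems by auto
  with Cons.IH a show ?case
    by blast
qed auto

lemma sat_sentence_cong: "sentence L \<phi> \<Longrightarrow> sat M e \<phi> \<longleftrightarrow> sat M e' \<phi>"
  by (intro sat_cong) (auto simp: sentence_def)

text \<open>If the sentence failed in \<open>A\<close>, its negation would belong to the complete
  theory and hold in \<open>M\<close>.\<close>

lemma complete_theory_transfer:
  assumes "models M (complete_theory L A)" "sentence L \<phi>" "sat M e \<phi>" "range e \<subseteq> univ M"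
    and "range e' \<subseteq> univ A"
  shows "sat A e' \<phi>"
proof (rule ccontr)
  assume "\<not> sat A e' \<phi>"
  then have "models A {Neg \<phi>}"
    using sat_sentence_cong[OF assms(2), of A e'] by (auto simp: models_def)
  then have "Neg \<phi> \<in> complete_theory L A"
    using assms(2) by (auto simp: complete_theory_def sentence_def)
  then show False
    using assms by (auto simp: models_def)
qed

text \<open>A finite part of an ict-pattern is asserted by a single sentence. Injective renamings, applied
  to bound variables as well, give the parameters of the different formulas disjoint sets of variables
  without any capture.\<close>

definition par_var :: "nat \<Rightarrow> nat \<Rightarrow> nat \<Rightarrow> nat" where
  "par_var i j k = (if k = 0 then 0 else Suc (prod_encode (prod_encode (i, j), k)))"

lemma inj_par_var: "inj (par_var i j)"
  by (auto simp: inj_def par_var_def split: if_splits)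

text \<open>Each choice \<eta> is realized only in some elementary extension \<open>N\<close>.
  Stated as an existential formula about the parameters, its finite part descends from
  \<open>N\<close> to \<open>M\<close>. Quantifying the parameters away, by one block outside the
  conjunction over all \<eta>, yields a sentence that passes to \<open>A\<close> with the same
  parameters for every \<eta>.\<close>

lemma finite_pattern_transfer:
  fixes M :: "('f, 'r, 'm) struct" and A :: "('f, 'r, 's) struct"
    and a :: "nat \<Rightarrow> nat \<Rightarrow> nat \<Rightarrow> 'm" and K :: nat
  assumes pat: "ict_pattern L M 1 \<pi> {..<d} \<phi> a"
    and M: "is_struct L M" "models M (complete_theory L A)" and A: "is_struct L A"
  shows "\<exists>a'. \<forall>\<eta> :: nat \<Rightarrow> nat. (\<forall>i<d. \<eta> i < K) \<longrightarrow>
    (\<exists>b\<in>univ A. \<forall>i<d. \<forall>j<K. sat A (\<lambda>k. if k = 0 then b else a' i j k) (\<phi> i) \<longleftrightarrow> j = \<eta> i)"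
proof -
  obtain m where m: "m \<in> univ M"
    using M by (auto simp: is_struct_def)
  \<comment> \<open>One assignment holds all parameters under the renaming \<open>par_var\<close>.
    Position 0 is kept for the object variable; \<open>m\<close> is a default where
    \<open>i \<ge> d\<close>, since \<open>a\<close> is known to stay in the universe only for
    \<open>i < d\<close>.\<close>
  define e where "e v = (case v of 0 \<Rightarrow> m | Suc w \<Rightarrow> let (p, k) = prod_decode w; (i, j) = prod_decode p
    in if i < d then a i j k else m)" for v
  have e: "range e \<subseteq> univ M"
    using pat m by (auto simp: e_def ict_pattern_def Let_def image_subset_iff split: nat.split prod.split)
  define lit where "lit \<eta> i j = (let \<psi> = ren_fm (par_var i j) (\<phi> i) in
    if j = \<eta> ! i then \<psi> else Neg \<psi>)" for \<eta> i j
  \<comment> \<open>All renamed copies share variable 0, so a single quantifier gives them a common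
    realization.\<close>
  define row where "row \<eta> = Exi 0 (conjs [lit \<eta> i j. i \<leftarrow> [0..<d], j \<leftarrow> [0..<K]])" for \<eta>
  define all where "all = conjs (map row (List.n_lists d [0..<K]))"
  define \<chi> where "\<chi> = exis (sorted_list_of_set (fv all)) all"
  have sat_lit: "sat B e' (lit \<eta> i j) \<longleftrightarrow> (sat B (e' \<circ> par_var i j) (\<phi> i) \<longleftrightarrow> j = \<eta> ! i)"
    for B :: "('f, 'r, 'x) struct" and e' \<eta> i j
    by (simp add: lit_def Let_def sat_ren_fm inj_par_var)
  have ball_upt: "(\<forall>i\<in>{0..<n}. Q i) \<longleftrightarrow> (\<forall>i<n. Q i)" for n :: nat and Q
    by auto
  have sat_row: "sat B e' (row \<eta>) \<longleftrightarrow> (\<exists>b\<in>univ B. \<forall>i<d. \<forall>j<K.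
      sat B (e'(0 := b) \<circ> par_var i j) (\<phi> i) \<longleftrightarrow> j = \<eta> ! i)" for B :: "('f, 'r, 'x) struct" and e' \<eta>
    by (simp add: row_def sat_conjs sat_lit ball_upt del: comp_apply fun_upd_apply)
  have wf: "wf_fm L all"
    using pat by (auto simp: all_def row_def lit_def Let_def ict_pattern_def intro!: wf_conjs wf_ren_fm)
  then have sent: "sentence L \<chi>"
    by (simp add: sentence_def \<chi>_def wf_exis fv_exis finite_fv)
  have "sat M e (row \<eta>)" if "\<eta> \<in> set (List.n_lists d [0..<K])" for \<eta>
  proof -
    let ?\<eta> = "\<lambda>i. \<eta> ! i"
    obtain N :: "('f, 'r, 'm) struct" and h b where N:
      "elementary_embedding L M N h" "range b \<subseteq> univ N"
      "\<And>i. i < d \<Longrightarrow> sat N (\<lambda>k. if k < 1 then b k else h (a i (?\<eta> i) k)) (\<phi> i)"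
      "\<And>i j. i < d \<Longrightarrow> j \<noteq> ?\<eta> i \<Longrightarrow> \<not> sat N (\<lambda>k. if k < 1 then b k else h (a i j k)) (\<phi> i)"
    proof -
      have "consistent L M 1
        ({(\<psi>, c) | \<psi> c. \<psi> \<in> \<pi> \<and> range c \<subseteq> univ M} \<union>
         {(\<phi> i, a i (?\<eta> i)) | i. i \<in> {..<d}} \<union>
         {(Neg (\<phi> i), a i j) | i j. i \<in> {..<d} \<and> j \<noteq> ?\<eta> i})"
        using pat unfolding ict_pattern_def by blast
      then obtain N :: "('f, 'r, 'm) struct" and h b where
        *: "elementary_embedding L M N h" "range b \<subseteq> univ N"
        and S: "\<forall>(\<psi>, c)\<in>({(\<psi>, c) | \<psi> c. \<psi> \<in> \<pi> \<and> range c \<subseteq> univ M} \<union>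
         {(\<phi> i, a i (?\<eta> i)) | i. i \<in> {..<d}} \<union>
         {(Neg (\<phi> i), a i j) | i j. i \<in> {..<d} \<and> j \<noteq> ?\<eta> i}).
           sat N (\<lambda>k. if k < 1 then b k else h (c k)) \<psi>"
        unfolding consistent_def by (elim exE conjE) (rule that)
      show ?thesis
      proof (rule that[OF *])
        show "sat N (\<lambda>k. if k < 1 then b k else h (a i (?\<eta> i) k)) (\<phi> i)" if "i < d" for i
          using bspec[OF S, of "(\<phi> i, a i (?\<eta> i))"] that by auto
        show "\<not> sat N (\<lambda>k. if k < 1 then b k else h (a i j k)) (\<phi> i)" if "i < d" "j \<noteq> ?\<eta> i" for i j
          using bspec[OF S, of "(Neg (\<phi> i), a i j)"] that by auto
      qed
    qed
    have "(h \<circ> e)(0 := b 0) \<circ> par_var i j = (\<lambda>k. if k < 1 then b k else h (a i j k))" if "i < d" for i j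
      using that by (auto simp: fun_eq_iff par_var_def e_def)
    with N have "sat N (h \<circ> e) (row \<eta>)"
      unfolding sat_row by (intro bexI[of _ "b 0"]) (auto simp: image_subset_iff simp del: comp_apply fun_upd_apply)
    moreover have "wf_fm L (row \<eta>)"
      using pat by (auto simp: row_def lit_def Let_def ict_pattern_def intro!: wf_conjs wf_ren_fm)
    ultimately show ?thesis
      using N(1) e unfolding elementary_embedding_def by blast
  qed
  then have "sat M e \<chi>"
    unfolding \<chi>_def by (intro sat_exisI e) (auto simp: all_def sat_conjs)
  moreover obtain p where p: "p \<in> univ A"
    using A by (auto simp: is_struct_def)
  ultimately have "sat A (\<lambda>_. p) \<chi>"
    using complete_theory_transfer[OF M(2) sent _ e, of "\<lambda>_. p"] by auto
  then obtain e' where e': "sat A e' all"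
    using sat_exisE[of A "\<lambda>_. p"] p unfolding \<chi>_def by blast
  show ?thesis
  proof (intro exI allI impI)
    fix \<eta> :: "nat \<Rightarrow> nat" assume \<eta>: "\<forall>i<d. \<eta> i < K"
    then have "map \<eta> [0..<d] \<in> set (List.n_lists d [0..<K])"
      by (auto simp: set_n_lists)
    then have "sat A e' (row (map \<eta> [0..<d]))"
      using e' by (auto simp: all_def sat_conjs)
    moreover have "e'(0 := b) \<circ> par_var i j = (\<lambda>k. if k = 0 then b else e' (par_var i j k))" for b i j
      by (auto simp: fun_eq_iff par_var_def)
    ultimately show "\<exists>b\<in>univ A. \<forall>i<d. \<forall>j<K.
        sat A (\<lambda>k. if k = 0 then b else e' (par_var i j k)) (\<phi> i) \<longleftrightarrow> j = \<eta> i"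
      unfolding sat_row by (simp del: comp_apply fun_upd_apply)
  qed
qed

section \<open>Isomorphic structures and subpatterns\<close>

definition struct_iso ::
  "('f, 'r) signature \<Rightarrow> ('f, 'r, 'a) struct \<Rightarrow> ('f, 'r, 'b) struct \<Rightarrow> ('a \<Rightarrow> 'b) \<Rightarrow> bool" where
  "struct_iso L A B h \<longleftrightarrow> bij_betw h (univ A) (univ B) \<and>
     (\<forall>g as. length as = fun_arity L g \<and> set as \<subseteq> univ A \<longrightarrow>
        fun_int B g (map h as) = h (fun_int A g as)) \<and>
     (\<forall>r as. length as = rel_arity L r \<and> set as \<subseteq> univ A \<longrightarrow>
        rel_int B r (map h as) = rel_int A r as)"

lemma eval_trm_univ:
  "is_struct L A \<Longrightarrow> wf_trm L t \<Longrightarrow> range e \<subseteq> univ A \<Longrightarrow> eval_trm A e t \<in> univ A"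
  by (induction t) (auto simp: is_struct_def image_subset_iff)

lemma eval_trm_iso:
  assumes "struct_iso L A B h" "is_struct L A" "wf_trm L t" "range e \<subseteq> univ A"
  shows "eval_trm B (h \<circ> e) t = h (eval_trm A e t)"
  using assms(3)
proof (induction t)
  case (Fn g ts)
  have "set (map (eval_trm A e) ts) \<subseteq> univ A"
    using Fn.prems assms eval_trm_univ[OF assms(2) _ assms(4)] by auto
  moreover have "map (eval_trm B (h \<circ> e)) ts = map h (map (eval_trm A e) ts)"
    using Fn by (auto simp del: comp_apply simp: o_def[of h "eval_trm A e"])
  ultimately show ?case
    using assms(1) Fn.prems unfolding struct_iso_def
    by (metis eval_trm.simps(2) length_map wf_trm.simps(2))
qed auto

lemma sat_iso:
  assumes "struct_iso L A B h" "is_struct L A" "wf_fm L \<phi>" "range e \<subseteq> univ A"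
  shows "sat B (h \<circ> e) \<phi> \<longleftrightarrow> sat A e \<phi>"
  using assms(3,4)
proof (induction \<phi> arbitrary: e)
  case (Eq s t)
  have "inj_on h (univ A)"
    using assms(1) by (auto simp: struct_iso_def bij_betw_def)
  then show ?case
    using Eq eval_trm_univ[OF assms(2)] by (simp add: eval_trm_iso[OF assms(1,2)] inj_on_eq_iff del: comp_apply)
next
  case (Rl r ts)
  have "set (map (eval_trm A e) ts) \<subseteq> univ A"
    using Rl assms eval_trm_univ[OF assms(2)] by auto
  moreover have "map (eval_trm B (h \<circ> e)) ts = map h (map (eval_trm A e) ts)"
    using Rl eval_trm_iso[OF assms(1,2)] by (auto simp del: comp_apply simp: o_def[of h "eval_trm A e"])
  ultimately show ?case
    using assms(1) Rl.prems unfolding struct_iso_def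
    by (metis sat.simps(2) length_map wf_fm.simps(2))
next
  case (Exi k \<phi>)
  have "sat B ((h \<circ> e)(k := h a)) \<phi> \<longleftrightarrow> sat A (e(k := a)) \<phi>" if "a \<in> univ A" for a
  proof -
    have "range (e(k := a)) \<subseteq> univ A"
      using that Exi.prems by auto
    then have "sat B (h \<circ> e(k := a)) \<phi> \<longleftrightarrow> sat A (e(k := a)) \<phi>"
      using Exi by (metis wf_fm.simps(5))
    then show ?thesis
      by (simp add: fun_upd_comp)
  qed
  moreover have "univ B = h ` univ A"
    using assms(1) by (auto simp: struct_iso_def bij_betw_def)
  ultimately show ?case
    by (simp del: comp_apply fun_upd_apply)
qed auto

lemma models_iso:
  assumes "struct_iso L A B h" "is_struct L A" "sentence L \<phi>"
  shows "models B {\<phi>} \<longleftrightarrow> models A {\<phi>}"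
proof -
  obtain a where a: "a \<in> univ A"
    using assms(2) by (auto simp: is_struct_def)
  have "h a \<in> univ B"
    using assms(1) a by (auto simp: struct_iso_def bij_betw_def)
  moreover have "sat B (h \<circ> (\<lambda>_. a)) \<phi> \<longleftrightarrow> sat A (\<lambda>_. a) \<phi>"
    using assms a by (intro sat_iso) (auto simp: sentence_def)
  ultimately have "models B {\<phi>} \<longleftrightarrow> sat B (\<lambda>_. h a) \<phi>" "sat B (\<lambda>_. h a) \<phi> \<longleftrightarrow> sat A (\<lambda>_. a) \<phi>"
    using sat_sentence_cong[OF assms(3), of B] by (fastforce simp: models_def o_def)+
  moreover have "models A {\<phi>} \<longleftrightarrow> sat A (\<lambda>_. a) \<phi>"
    using a sat_sentence_cong[OF assms(3), of A] by (fastforce simp: models_def)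
  ultimately show ?thesis
    by simp
qed

lemma complete_theory_iso:
  "struct_iso L A B h \<Longrightarrow> is_struct L A \<Longrightarrow> complete_theory L B = complete_theory L A"
  using models_iso[of L A B h] by (auto simp: complete_theory_def)

lemma models_complete_theory: "models A (complete_theory L A)"
  by (auto simp: models_def complete_theory_def)

lemma consistent_mono:
  fixes M :: "('f, 'r, 'm) struct"
  assumes "consistent L M n \<Sigma>'" "\<Sigma> \<subseteq> \<Sigma>'"
  shows "consistent L M n \<Sigma>"
proof -
  obtain N :: "('f, 'r, 'm) struct" and h b where "is_struct L N" "elementary_embedding L M N h"
    "range b \<subseteq> univ N"
    and *: "\<forall>(\<phi>, c)\<in>\<Sigma>'. sat N (\<lambda>k. if k < n then b k else h (c k)) \<phi>"
    using assms(1) unfolding consistent_def by (elim exE conjE) (rule that)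
  moreover have "\<forall>(\<phi>, c)\<in>\<Sigma>. sat N (\<lambda>k. if k < n then b k else h (c k)) \<phi>"
    using * assms(2) by (intro ballI) (rule bspec, assumption, erule subsetD)
  ultimately show ?thesis
    unfolding consistent_def by (intro exI conjI)
qed

text \<open>Conditions on part of the index set form a subset of the conditions on all of it. This
  is how a pattern of any depth above 2 yields one of depth 3.\<close>

lemma ict_pattern_reindex:
  assumes pat: "ict_pattern L M n \<pi> I \<phi> a" and g: "inj_on g J" "g ` J \<subseteq> I"
  shows "ict_pattern L M n \<pi> J (\<lambda>i. \<phi> (g i)) (\<lambda>i. a (g i))"
proof -
  let ?S = "\<lambda>\<eta>. {(\<psi>, c) | \<psi> c. \<psi> \<in> \<pi> \<and> range c \<subseteq> univ M} \<union>
         {(\<phi> i, a i (\<eta> i)) | i. i \<in> I} \<union>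
         {(Neg (\<phi> i), a i j) | i j. i \<in> I \<and> j \<noteq> \<eta> i}"
  let ?S' = "\<lambda>\<eta>. {(\<psi>, c) | \<psi> c. \<psi> \<in> \<pi> \<and> range c \<subseteq> univ M} \<union>
         {(\<phi> (g i), a (g i) (\<eta> i)) | i. i \<in> J} \<union>
         {(Neg (\<phi> (g i)), a (g i) j) | i j. i \<in> J \<and> j \<noteq> \<eta> i}"
  have wf: "\<forall>i\<in>I. wf_fm L (\<phi> i)" and rng: "\<forall>i\<in>I. \<forall>j. range (a i j) \<subseteq> univ M"
    and con: "\<And>\<eta>. consistent L M n (?S \<eta>)"
    using pat unfolding ict_pattern_def by blast+
  have gI: "g i \<in> I" if "i \<in> J" for i
    using that g(2) by blast
  have "consistent L M n (?S' \<eta>)" for \<eta>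
  proof (rule consistent_mono[OF con[of "\<eta> \<circ> inv_into J g"]], intro Un_mono subset_refl subsetI)
    fix x assume "x \<in> {(\<phi> (g i), a (g i) (\<eta> i)) | i. i \<in> J}"
    then obtain i where "i \<in> J" "x = (\<phi> (g i), a (g i) (\<eta> i))"
      by blast
    then show "x \<in> {(\<phi> i, a i ((\<eta> \<circ> inv_into J g) i)) | i. i \<in> I}"
      using gI g(1) by (intro CollectI exI[of _ "g i"]) simp
  next
    fix x assume "x \<in> {(Neg (\<phi> (g i)), a (g i) j) | i j. i \<in> J \<and> j \<noteq> \<eta> i}"
    then obtain i j where "i \<in> J" "j \<noteq> \<eta> i" "x = (Neg (\<phi> (g i)), a (g i) j)"
      by blast
    then show "x \<in> {(Neg (\<phi> i), a i j) | i j. i \<in> I \<and> j \<noteq> (\<eta> \<circ> inv_into J g) i}"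
      using gI g(1) by (intro CollectI exI[of _ "g i"] exI[of _ j]) simp
  qed
  with wf rng gI show ?thesis
    unfolding ict_pattern_def by blast
qed

text \<open>Models have to live on a prescribed infinite type; this carries a structure there along
  an injection.\<close>

lemma struct_iso_image:
  assumes "inj_on f (univ A)" "is_struct L A"
  defines "B \<equiv> \<lparr>univ = f ` univ A, fun_int = \<lambda>g as. f (fun_int A g (map (inv_into (univ A) f) as)),
    rel_int = \<lambda>r as. rel_int A r (map (inv_into (univ A) f) as)\<rparr>"
  shows "struct_iso L A B f" "is_struct L B"
proof -
  have "map (inv_into (univ A) f) (map f as) = as" if "set as \<subseteq> univ A" for as
    using that assms(1) by (auto intro!: map_idI)
  then show "struct_iso L A B f"
    using assms(1) by (simp add: struct_iso_def B_def bij_betw_def del: map_map)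
  have "set (map (inv_into (univ A) f) as) \<subseteq> univ A" if "set as \<subseteq> f ` univ A" for as
    using that by (auto intro: inv_into_into)
  then show "is_struct L B"
    using assms(2) by (simp add: is_struct_def B_def)
qed

lemma elementary_embedding_id: "elementary_embedding L M M id"
  by (simp add: elementary_embedding_def)

section \<open>Presburger arithmetic with two sorts\<close>

text \<open>The variable \<open>(k, s)\<close> is the exponent of \<open>x\<close> (if \<open>s = False\<close>) or of \<open>y\<close> (if \<open>s = True\<close>) of the
  element denoted by \<open>Var k\<close>. Linear functions never mix the two sorts, and this survives quantifier
  elimination.\<close>

type_synonym coords = "nat \<times> bool \<Rightarrow> int"

inductive lin :: "bool \<Rightarrow> (coords \<Rightarrow> int) \<Rightarrow> bool" for s where
  const: "lin s (\<lambda>e. c)"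
| var: "lin s (\<lambda>e. e (k, s))"
| add: "lin s f \<Longrightarrow> lin s g \<Longrightarrow> lin s (\<lambda>e. f e + g e)"
| scale: "lin s f \<Longrightarrow> lin s (\<lambda>e. c * f e)"

lemma lin_uminus: "lin s f \<Longrightarrow> lin s (\<lambda>e. - f e)"
  using lin.scale[of s f "-1"] by simp

lemma lin_diff: "lin s f \<Longrightarrow> lin s g \<Longrightarrow> lin s (\<lambda>e. f e - g e)"
  using lin.add[OF _ lin_uminus, of s f g] by simp

lemma lin_upd_other: "lin s f \<Longrightarrow> s \<noteq> s' \<Longrightarrow> f (e((k, s') := x)) = f e"
  by (induction rule: lin.induct) auto

text \<open>Linear functions are semantic objects, so "not containing the variable" is expressed as
  invariance under updates of it.\<close>

lemma lin_split:
  assumes "lin s f"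
  shows "\<exists>c g. lin s g \<and> (\<forall>e x. g (e((k, s) := x)) = g e) \<and> (\<forall>e. f e = c * e (k, s) + g e)"
  using assms
proof induction
  case (const c)
  show ?case
    by (intro exI[of _ 0] exI[of _ "\<lambda>e. c"]) (auto intro: lin.const)
next
  case (var j)
  show ?case
  proof (cases "j = k")
    case True
    then show ?thesis
      by (intro exI[of _ 1] exI[of _ "\<lambda>e. 0"]) (auto intro: lin.const)
  next
    case False
    then show ?thesis
      by (intro exI[of _ 0] exI[of _ "\<lambda>e. e (j, s)"]) (auto intro: lin.var)
  qed
next
  case (add f f')
  then obtain c g c' g' where
    "lin s g" "\<forall>e x. g (e((k, s) := x)) = g e" "\<forall>e. f e = c * e (k, s) + g e"
    "lin s g'" "\<forall>e x. g' (e((k, s) := x)) = g' e" "\<forall>e. f' e = c' * e (k, s) + g' e"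
    by blast
  then show ?case
    by (intro exI[of _ "c + c'"] exI[of _ "\<lambda>e. g e + g' e"])
      (auto intro: lin.add simp: algebra_simps simp del: fun_upd_apply)
next
  case (scale f d)
  then obtain c g where
    "lin s g" "\<forall>e x. g (e((k, s) := x)) = g e" "\<forall>e. f e = c * e (k, s) + g e"
    by blast
  then show ?case
    by (intro exI[of _ "d * c"] exI[of _ "\<lambda>e. d * g e"])
      (auto intro: lin.scale simp: algebra_simps simp del: fun_upd_apply)
qed

text \<open>Presburger predicates without a constructor for quantifiers: closure under them is the
  elimination theorem \<open>pres_ex\<close>. Divisibility atoms are what makes that closure
  possible.\<close>

inductive pres :: "(coords \<Rightarrow> bool) \<Rightarrow> bool" where
  pos: "lin s f \<Longrightarrow> pres (\<lambda>e. 0 < f e)"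
| dvd: "lin s f \<Longrightarrow> 0 < d \<Longrightarrow> pres (\<lambda>e. d dvd f e)"
| neg: "pres P \<Longrightarrow> pres (\<lambda>e. \<not> P e)"
| conj: "pres P \<Longrightarrow> pres Q \<Longrightarrow> pres (\<lambda>e. P e \<and> Q e)"

lemma pres_disj: "pres P \<Longrightarrow> pres Q \<Longrightarrow> pres (\<lambda>e. P e \<or> Q e)"
  using pres.neg[OF pres.conj[OF pres.neg pres.neg], of P Q] by simp

lemma pres_const: "pres (\<lambda>e. b)"
  using pres.pos[OF lin.const[of True "if b then 1 else 0"]] by (cases b) simp_all

lemma pres_bex: "finite S \<Longrightarrow> (\<And>i. i \<in> S \<Longrightarrow> pres (P i)) \<Longrightarrow> pres (\<lambda>e. \<exists>i\<in>S. P i e)"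
  by (induction S rule: finite_induct) (auto intro: pres_const pres_disj)

text \<open>As a function of one variable, a Presburger predicate only depends on a residue and on the
  position relative to finitely many cuts, which are linear in the other variables of the same sort.\<close>

definition is_cut :: "bool \<Rightarrow> (coords \<Rightarrow> int) \<Rightarrow> bool" where
  "is_cut s q \<longleftrightarrow> (\<exists>c t. 0 < c \<and> lin s t \<and> q = (\<lambda>e. t e div c))"

definition cut_equiv :: "int \<Rightarrow> int set \<Rightarrow> int \<Rightarrow> int \<Rightarrow> bool" where
  "cut_equiv D Q x y \<longleftrightarrow> x mod D = y mod D \<and> (\<forall>q\<in>Q. x \<le> q \<longleftrightarrow> y \<le> q)"

text \<open>Rounding turns an inequality with leading coefficient \<open>c\<close> into a comparison
  with one integer, which is why cuts have the form \<open>t div c\<close>.\<close>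

lemma le_div_iff:
  fixes c x t :: int
  assumes "0 < c"
  shows "x \<le> t div c \<longleftrightarrow> c * x \<le> t"
proof
  assume "x \<le> t div c"
  then have "c * x \<le> c * (t div c)"
    using assms by simp
  also have "\<dots> \<le> t"
    using assms mult_div_mod_eq[of c t] pos_mod_sign[of c t] by linarith
  finally show "c * x \<le> t" .
next
  assume "c * x \<le> t"
  then show "x \<le> t div c"
    using zdiv_mono1[of "c * x" t c] assms by simp
qed

lemma cut_equiv_mono: "cut_equiv D' Q' x y \<Longrightarrow> D dvd D' \<Longrightarrow> Q \<subseteq> Q' \<Longrightarrow> cut_equiv D Q x y"
  unfolding cut_equiv_def using mod_mod_cancel[of D D' x] mod_mod_cancel[of D D' y] by auto

lemma lin_splitE:
  assumes "lin s f"
  obtains c g where "lin s g" "\<And>e x. g (e((k, s) := x)) = g e" "\<And>e. f e = c * e (k, s) + g e"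
  using lin_split[OF assms, of k] by blast

text \<open>An atom of the other sort does not see the variable, an inequality contributes at most
  one cut, and a divisibility contributes its modulus; conjunction multiplies moduli and unites
  cuts. It matters that \<open>D\<close> and \<open>C\<close> are chosen before the assignment
  \<open>e\<close>.\<close>

lemma pres_cuts:
  assumes "pres P"
  shows "\<exists>D C. 0 < D \<and> finite C \<and> (\<forall>q\<in>C. is_cut s q) \<and>
    (\<forall>e x y. cut_equiv D ((\<lambda>q. q e) ` C) x y \<longrightarrow> P (e((k, s) := x)) = P (e((k, s) := y)))"
  using assms
proof induction
  case (pos s' f)
  show ?case
  proof (cases "s' = s")
    case False
    have "f (e((k, s) := x)) = f e" for e x
      by (rule lin_upd_other[OF pos False])
    then show ?thesis
      by (intro exI[of _ 1] exI[of _ "{}"]) (simp del: fun_upd_apply)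
  next
    case True
    have "lin s f"
      using pos True by simp
    then obtain c g where g: "lin s g" "\<And>e x. g (e((k, s) := x)) = g e" "\<And>e. f e = c * e (k, s) + g e"
      by (rule lin_splitE[where k = k]) (erule that)
    consider "c = 0" | "c > 0" | "c < 0"
      by linarith
    then show ?thesis
    proof cases
      case 1
      then show ?thesis
        by (intro exI[of _ 1] exI[of _ "{}"]) (auto simp: g fun_upd_same simp del: fun_upd_apply)
    next
      case 2
      \<comment> \<open>\<open>0 < c * x + g\<close> is the negation of
        \<open>c * x \<le> - g\<close>.\<close>
      then have "is_cut s (\<lambda>e. (- g e) div c)"
        using g(1) by (auto simp: is_cut_def intro!: exI[of _ c] exI[of _ "\<lambda>e. - g e"] lin_uminus)
      moreover have "0 < f (e((k, s) := x)) \<longleftrightarrow> \<not> x \<le> (- g e) div c" for e x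
        using 2 by (auto simp: g le_div_iff fun_upd_same simp del: fun_upd_apply)
      ultimately show ?thesis
        by (intro exI[of _ 1] exI[of _ "{\<lambda>e. (- g e) div c}"]) (auto simp: cut_equiv_def simp del: fun_upd_apply)
    next
      case 3
      \<comment> \<open>Over the integers, \<open>0 < c * x + g\<close> means
        \<open>(- c) * x \<le> g - 1\<close>; the 1 comes from strictness.\<close>
      then have "is_cut s (\<lambda>e. (g e - 1) div (- c))"
        using g(1) by (auto simp: is_cut_def intro!: exI[of _ "-c"] exI[of _ "\<lambda>e. g e - 1"] lin_diff lin.const)
      moreover have "0 < f (e((k, s) := x)) \<longleftrightarrow> x \<le> (g e - 1) div (- c)" for e x
        using 3 by (subst le_div_iff) (auto simp: g fun_upd_same simp del: fun_upd_apply)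
      ultimately show ?thesis
        by (intro exI[of _ 1] exI[of _ "{\<lambda>e. (g e - 1) div (- c)}"]) (auto simp: cut_equiv_def simp del: fun_upd_apply)
    qed
  qed
next
  case (dvd s' f d)
  show ?case
  proof (cases "s' = s")
    case False
    have "f (e((k, s) := x)) = f e" for e x
      by (rule lin_upd_other[OF dvd(1) False])
    then show ?thesis
      by (intro exI[of _ 1] exI[of _ "{}"]) (simp del: fun_upd_apply)
  next
    case True
    have "lin s f"
      using dvd(1) True by simp
    then obtain c g where g: "lin s g" "\<And>e x. g (e((k, s) := x)) = g e" "\<And>e. f e = c * e (k, s) + g e"
      by (rule lin_splitE[where k = k]) (erule that)
    have "d dvd c * x + g e \<longleftrightarrow> d dvd c * y + g e" if "x mod d = y mod d" for x y e
    proof -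
      have "(c * x + g e) mod d = (c * y + g e) mod d"
        using that by (metis mod_add_left_eq mod_mult_right_eq)
      then show ?thesis
        by (simp add: dvd_eq_mod_eq_0)
    qed
    then have "\<forall>e x y. cut_equiv d ((\<lambda>q. q e) ` {}) x y \<longrightarrow>
        (d dvd f (e((k, s) := x))) = (d dvd f (e((k, s) := y)))"
      unfolding cut_equiv_def g fun_upd_same by blast
    with dvd show ?thesis
      by (intro exI[of _ d] exI[of _ "{}"]) (simp del: fun_upd_apply)
  qed
next
  case (neg P)
  then obtain D C where "0 < D" "finite C" "\<forall>q\<in>C. is_cut s q"
    "\<forall>e x y. cut_equiv D ((\<lambda>q. q e) ` C) x y \<longrightarrow> P (e((k, s) := x)) = P (e((k, s) := y))"
    by blast
  then show ?case
    by (intro exI[of _ D] exI[of _ C]) blast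
next
  case (conj P Q)
  then obtain D C D' C' where
    1: "0 < D" "finite C" "\<forall>q\<in>C. is_cut s q"
    "\<forall>e x y. cut_equiv D ((\<lambda>q. q e) ` C) x y \<longrightarrow> P (e((k, s) := x)) = P (e((k, s) := y))"
    and 2: "0 < D'" "finite C'" "\<forall>q\<in>C'. is_cut s q"
    "\<forall>e x y. cut_equiv D' ((\<lambda>q. q e) ` C') x y \<longrightarrow> Q (e((k, s) := x)) = Q (e((k, s) := y))"
    by (elim exE conjE) (rule that)
  have "P (e((k, s) := x)) = P (e((k, s) := y)) \<and> Q (e((k, s) := x)) = Q (e((k, s) := y))"
    if "cut_equiv (D * D') ((\<lambda>q. q e) ` (C \<union> C')) x y" for e x y
    by (intro conjI 1(4)[rule_format] 2(4)[rule_format]; rule cut_equiv_mono[OF that]) auto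
  then have "\<forall>e x y. cut_equiv (D * D') ((\<lambda>q. q e) ` (C \<union> C')) x y \<longrightarrow>
      (P (e((k, s) := x)) \<and> Q (e((k, s) := x))) = (P (e((k, s) := y)) \<and> Q (e((k, s) := y)))"
    by blast
  moreover have "\<forall>q\<in>C \<union> C'. is_cut s q" "0 < D * D'" "finite (C \<union> C')"
    using 1(1-3) 2(1-3) by auto
  ultimately show ?case
    by (intro exI[of _ "D * D'"] exI[of _ "C \<union> C'"] conjI)
qed

text \<open>Test points: sliding down (or, below all cuts, starting from the lowest one) by multiples of
  \<open>D\<close> stays in the same class until the distance to a cut is at most \<open>D\<close>.\<close>

lemma cut_equiv_witness:
  assumes "finite Q" "0 < D"
  shows "\<exists>y\<in>{0..<D} \<union> (\<Union>q\<in>Q. (\<lambda>j. q + j) ` {-D..D}). cut_equiv D Q x y"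
proof (cases "Q = {}")
  case True
  then show ?thesis
    using assms by (intro bexI[of _ "x mod D"]) (auto simp: cut_equiv_def simp del: fun_upd_apply)
next
  case False
  show ?thesis
  proof (cases "\<exists>q\<in>Q. q < x")
    case True
    define q where "q = Max {q\<in>Q. q < x}"
    have "q \<in> {q\<in>Q. q < x}"
      using True assms unfolding q_def by (intro Max_in) auto
    moreover have "q' \<le> q" if "q' \<in> Q" "q' < x" for q'
      using that assms by (simp add: q_def)
    ultimately have q: "q \<in> Q" "q < x" "\<And>q'. q' \<in> Q \<Longrightarrow> q' < x \<Longrightarrow> q' \<le> q"
      by auto
    \<comment> \<open>The least integer above \<open>q\<close> congruent to \<open>x\<close>. As
      \<open>q\<close> is the greatest cut below \<open>x\<close>, no cut \<open>q'\<close>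
      satisfies \<open>y \<le> q' < x\<close>.\<close>
    define y where "y = q + 1 + (x - q - 1) mod D"
    have m: "0 \<le> (x - q - 1) mod D" "(x - q - 1) mod D < D" "(x - q - 1) mod D \<le> x - q - 1"
      using assms q(2) zmod_le_nonneg_dividend[of "x - q - 1" D] by (simp_all del: diff_diff_eq)
    have "y mod D = x mod D"
      unfolding y_def by (simp add: mod_add_right_eq)
    moreover have "q < y" "y \<le> x"
      using m by (auto simp: y_def)
    ultimately have "cut_equiv D Q x y"
      using q unfolding cut_equiv_def by force
    moreover have "y \<in> (\<lambda>j. q + j) ` {-D..D}"
      using m by (intro image_eqI[of _ _ "y - q"]) (auto simp: y_def)
    ultimately show ?thesis
      using q(1) by blast
  next
    case below: False
    define q where "q = Min Q"
    have q: "q \<in> Q" "\<And>q'. q' \<in> Q \<Longrightarrow> q \<le> q'"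
      using False assms by (auto simp: q_def)
    \<comment> \<open>The greatest integer up to the lowest cut \<open>q\<close> that is congruent
      to \<open>x\<close>; both \<open>x\<close> and \<open>y\<close> are at most every cut.\<close>
    define y where "y = q - (q - x) mod D"
    have m: "0 \<le> (q - x) mod D" "(q - x) mod D < D"
      using assms by auto
    have "y mod D = x mod D"
      unfolding y_def by (simp add: mod_diff_right_eq)
    then have "cut_equiv D Q x y"
      using q(2) below m(1) unfolding cut_equiv_def y_def by force
    moreover have "y \<in> (\<lambda>j. q + j) ` {-D..D}"
      using m by (intro image_eqI[of _ _ "y - q"]) (auto simp: y_def)
    ultimately show ?thesis
      using q(1) by blast
  qed
qed

section \<open>Substitution of cuts and quantifier elimination\<close>

text \<open>When \<open>c\<close> divides \<open>t\<close>, multiplying an atom by \<open>c\<close>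
  clears the denominator: \<open>a * (t div c) + g\<close> becomes \<open>a * t + c * g\<close>, and
  a modulus \<open>d\<close> becomes \<open>c * d\<close>.\<close>

lemma pres_subst_exact:
  assumes "pres P" "lin s t" "0 < c"
  shows "\<exists>Q. pres Q \<and> (\<forall>e. c dvd t e \<longrightarrow> Q e = P (e((k, s) := t e div c)))"
  using assms(1)
proof induction
  case (pos s' f)
  show ?case
  proof (cases "s' = s")
    case False
    have "f (e((k, s) := x)) = f e" for e x
      by (rule lin_upd_other[OF pos False])
    then show ?thesis
      using pres.pos[OF pos] by (intro exI[of _ "\<lambda>e. 0 < f e"]) (simp del: fun_upd_apply)
  next
    case True
    have "lin s f"
      using pos True by simp
    then obtain a g where g: "lin s g" "\<And>e x. g (e((k, s) := x)) = g e" "\<And>e. f e = a * e (k, s) + g e"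
      by (rule lin_splitE[where k = k]) (erule that)
    have "0 < a * t e + c * g e \<longleftrightarrow> 0 < f (e((k, s) := t e div c))" if "c dvd t e" for e
    proof -
      have "a * t e + c * g e = c * (a * (t e div c) + g e)"
        using that by (auto simp: algebra_simps elim: dvdE)
      then show ?thesis
        using assms(3) by (simp add: g zero_less_mult_iff fun_upd_same del: fun_upd_apply)
    qed
    moreover have "pres (\<lambda>e. 0 < a * t e + c * g e)"
      using g(1) assms(2) by (intro pres.pos[of s] lin.intros)
    ultimately show ?thesis
      by blast
  qed
next
  case (dvd s' f d)
  show ?case
  proof (cases "s' = s")
    case False
    have "f (e((k, s) := x)) = f e" for e x
      by (rule lin_upd_other[OF dvd(1) False])
    then show ?thesis
      using pres.dvd[OF dvd] by (intro exI[of _ "\<lambda>e. d dvd f e"]) (simp del: fun_upd_apply)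
  next
    case True
    have "lin s f"
      using dvd(1) True by simp
    then obtain a g where g: "lin s g" "\<And>e x. g (e((k, s) := x)) = g e" "\<And>e. f e = a * e (k, s) + g e"
      by (rule lin_splitE[where k = k]) (erule that)
    have "c * d dvd a * t e + c * g e \<longleftrightarrow> d dvd f (e((k, s) := t e div c))" if "c dvd t e" for e
    proof -
      have "a * t e + c * g e = c * (a * (t e div c) + g e)"
        using that by (auto simp: algebra_simps elim: dvdE)
      then show ?thesis
        using assms(3) by (simp add: g)
    qed
    moreover have "pres (\<lambda>e. c * d dvd a * t e + c * g e)"
      using g(1) assms(2,3) dvd by (intro pres.dvd[of s] lin.intros) auto
    ultimately show ?thesis
      by blast
  qed
next
  case (neg P)
  then obtain Q where "pres Q" "\<forall>e. c dvd t e \<longrightarrow> Q e = P (e((k, s) := t e div c))"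
    by blast
  then show ?case
    by (intro exI[of _ "\<lambda>e. \<not> Q e"]) (auto intro: pres.neg simp del: fun_upd_apply)
next
  case (conj P P')
  then obtain Q Q' where "pres Q" "\<forall>e. c dvd t e \<longrightarrow> Q e = P (e((k, s) := t e div c))"
    "pres Q'" "\<forall>e. c dvd t e \<longrightarrow> Q' e = P' (e((k, s) := t e div c))"
    by blast
  then show ?case
    by (intro exI[of _ "\<lambda>e. Q e \<and> Q' e"]) (auto intro: pres.conj simp del: fun_upd_apply)
qed

text \<open>The floor is made exact by guessing the remainder: \<open>q + j\<close> is
  \<open>(t + c * j - r) div c\<close> for the correct \<open>r\<close> among \<open>0..<c\<close>,
  and the correct \<open>r\<close> is recognized by a divisibility atom.\<close>

lemma pres_subst:
  assumes "pres P" "is_cut s q"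
  shows "pres (\<lambda>e. P (e((k, s) := q e + j)))"
proof -
  obtain c t where ct: "0 < c" "lin s t" "q = (\<lambda>e. t e div c)"
    using assms(2) by (auto simp: is_cut_def)
  define t' where "t' r e = t e + (c * j - r)" for r e
  have lin: "lin s (t' r)" for r
    unfolding t'_def using ct by (intro lin.add lin.const)
  obtain Q where Q: "\<And>r. pres (Q r)"
    "\<And>r e. c dvd t' r e \<Longrightarrow> Q r e = P (e((k, s) := t' r e div c))"
    using pres_subst_exact[OF assms(1) lin ct(1), where k = k] by metis
  have "P (e((k, s) := q e + j)) \<longleftrightarrow> (\<exists>r\<in>{0..<c}. c dvd t' r e \<and> Q r e)" for e
  proof -
    have *: "c dvd t' r e \<longleftrightarrow> r = t e mod c" if "r \<in> {0..<c}" for r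
    proof -
      have "c dvd t' r e \<longleftrightarrow> c dvd t e - r"
        using dvd_add_left_iff[of c "c * j" "t e - r"] by (simp add: t'_def algebra_simps)
      also have "\<dots> \<longleftrightarrow> t e mod c = r mod c"
        by (simp add: mod_eq_dvd_iff)
      finally show ?thesis
        using that by auto
    qed
    let ?r = "t e mod c"
    have "?r \<in> {0..<c}"
      using ct by auto
    moreover have "t' ?r e = c * (q e + j)"
      using mult_div_mod_eq[of c "t e"] by (simp add: t'_def ct algebra_simps)
    ultimately show ?thesis
      using * Q(2)[of ?r e] ct(1) by auto
  qed
  then show ?thesis
    using Q(1) lin ct(1) by (simp, intro pres_bex pres.conj pres.dvd[of s]) auto
qed

text \<open>Cooper's elimination: by \<open>cut_equiv_witness\<close> a solution exists iff one
  exists at bounded distance from a cut, so the quantifier is a finite disjunction of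
  substitutions.\<close>

lemma pres_ex:
  assumes "pres P"
  shows "pres (\<lambda>e. \<exists>x. P (e((k, s) := x)))"
proof -
  obtain D C where DC: "0 < D" "finite C" "\<forall>q\<in>C. is_cut s q"
    "\<And>e x y. cut_equiv D ((\<lambda>q. q e) ` C) x y \<Longrightarrow> P (e((k, s) := x)) = P (e((k, s) := y))"
    using pres_cuts[OF assms] by metis
  \<comment> \<open>The extra cut 0 accounts for the test points \<open>0..<D\<close>, which
    represent all residues when there are no cuts.\<close>
  have "(\<exists>x. P (e((k, s) := x))) \<longleftrightarrow> (\<exists>q\<in>insert (\<lambda>e. 0) C. \<exists>j\<in>{-D..D}. P (e((k, s) := q e + j)))" for e
  proof
    assume "\<exists>x. P (e((k, s) := x))"
    then obtain x where x: "P (e((k, s) := x))" ..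
    obtain y where y: "y \<in> {0..<D} \<union> (\<Union>q\<in>(\<lambda>q. q e) ` C. (\<lambda>j. q + j) ` {-D..D})"
      "cut_equiv D ((\<lambda>q. q e) ` C) x y"
      using cut_equiv_witness[of "(\<lambda>q. q e) ` C" D x] DC by blast
    have "P (e((k, s) := y))"
      using DC(4)[OF y(2)] x by simp
    then show "\<exists>q\<in>insert (\<lambda>e. 0) C. \<exists>j\<in>{-D..D}. P (e((k, s) := q e + j))"
      using y(1) by fastforce
  qed blast
  moreover have "is_cut s (\<lambda>e. 0)"
    unfolding is_cut_def by (intro exI[of _ 1] exI[of _ "\<lambda>e. 0"]) (auto intro: lin.const)
  ultimately show ?thesis
    using DC by (simp del: bex_simps, intro pres_bex pres_subst assms) auto
qed

section \<open>Piecewise linear functions\<close>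

text \<open>Made for the sign in the multiplication: a guard \<open>P\<close> may speak of either
  sort, while the branches stay linear in sort \<open>s\<close>.\<close>

inductive pwlin :: "bool \<Rightarrow> (coords \<Rightarrow> int) \<Rightarrow> bool" for s where
  lin: "lin s f \<Longrightarrow> pwlin s f"
| if_pres: "pres P \<Longrightarrow> pwlin s f \<Longrightarrow> pwlin s g \<Longrightarrow> pwlin s (\<lambda>e. if P e then f e else g e)"

lemma pwlin_uminus: "pwlin s f \<Longrightarrow> pwlin s (\<lambda>e. - f e)"
proof (induction rule: pwlin.induct)
  case (if_pres P f g)
  then have "pwlin s (\<lambda>e. if P e then - f e else - g e)"
    by (intro pwlin.if_pres)
  then show ?case
    by (rule back_subst[of "pwlin s"]) auto
qed (auto intro: pwlin.lin lin_uminus)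

lemma pwlin_add: "pwlin s f \<Longrightarrow> pwlin s g \<Longrightarrow> pwlin s (\<lambda>e. f e + g e)"
proof (induction rule: pwlin.induct)
  case (lin f)
  from lin(2) show ?case
  proof (induction rule: pwlin.induct)
    case (lin g)
    then show ?case
      using \<open>lin s f\<close> by (intro pwlin.lin lin.add)
  next
    case (if_pres P g h)
    then have "pwlin s (\<lambda>e. if P e then f e + g e else f e + h e)"
      by (intro pwlin.if_pres)
    then show ?case
      by (rule back_subst[of "pwlin s"]) auto
  qed
next
  case (if_pres P f h)
  then have "pwlin s (\<lambda>e. if P e then f e + g e else h e + g e)"
    by (intro pwlin.if_pres)
  then show ?case
    by (rule back_subst[of "pwlin s"]) auto
qed

lemma pres_pwlin_pos: "pwlin s f \<Longrightarrow> pres (\<lambda>e. 0 < f e)"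
proof (induction rule: pwlin.induct)
  case (if_pres P f g)
  then have "pres (\<lambda>e. (P e \<and> 0 < f e) \<or> (\<not> P e \<and> 0 < g e))"
    by (intro pres_disj pres.conj pres.neg)
  then show ?case
    by (rule back_subst[of pres]) auto
qed (auto intro: pres.pos)

lemma pres_less: "pwlin s f \<Longrightarrow> pwlin s g \<Longrightarrow> pres (\<lambda>e. f e < g e)"
  using pres_pwlin_pos[OF pwlin_add[OF _ pwlin_uminus], of s g f] by simp

lemma pres_le: "pwlin s f \<Longrightarrow> pwlin s g \<Longrightarrow> pres (\<lambda>e. f e \<le> g e)"
  using pres.neg[OF pres_less, of s g f] by (simp add: not_less)

lemma pres_equal: "pwlin s f \<Longrightarrow> pwlin s g \<Longrightarrow> pres (\<lambda>e. f e = g e)"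
  using pres.conj[OF pres_le pres_le, of s f g s g f] by (simp add: eq_iff)

section \<open>Counting the patterns that points can realize\<close>

text \<open>Recording only the number of cuts from \<open>x\<close> upwards leaves
  \<open>card Q + 1\<close> possible positions; a bound linear in the number of cuts is what the
  count relies on.\<close>

definition cut_code :: "int \<Rightarrow> int set \<Rightarrow> int \<Rightarrow> int \<times> nat" where
  "cut_code D Q x = (x mod D, card {q\<in>Q. x \<le> q})"

text \<open>The sets of cuts from \<open>x\<close> upwards shrink as \<open>x\<close> grows, so they
  form a chain, and in a chain of finite sets the cardinality determines the set.\<close>

lemma cut_equiv_if_code_eq:
  assumes "finite Q" "cut_code D Q x = cut_code D Q y"
  shows "cut_equiv D Q x y"
proof -
  have *: "{q\<in>Q. x \<le> q} = {q\<in>Q. y \<le> q}" if "x \<le> y" "cut_code D Q x = cut_code D Q y" for x y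
    using that assms(1) by (intro card_subset_eq[symmetric]) (auto simp: cut_code_def)
  have "{q\<in>Q. x \<le> q} = {q\<in>Q. y \<le> q}"
    using *[of x y] *[of y x] assms(2) by (metis linear)
  then show ?thesis
    using assms(2) unfolding cut_equiv_def cut_code_def by auto
qed

lemma cut_code_in: "finite Q \<Longrightarrow> 0 < D \<Longrightarrow> cut_code D Q x \<in> {0..<D} \<times> {..card Q}"
  unfolding cut_code_def by (auto intro: card_mono)

lemma card_range_le_if_factors:
  assumes "finite (range h)" "\<And>p p'. h p = h p' \<Longrightarrow> g p = g p'"
  shows "card (range g) \<le> card (range h)"
proof -
  have "g p = (g \<circ> inv_into UNIV h) (h p)" for p
    using assms(2)[of p "inv_into UNIV h (h p)"] by (simp add: f_inv_into_f)
  then have "range g = (g \<circ> inv_into UNIV h) ` range h"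
    by auto
  then show ?thesis
    using card_image_le[OF assms(1), of "g \<circ> inv_into UNIV h"] by simp
qed

text \<open>An ict-pattern with \<open>K\<close> columns requires the graph of every \<eta> to occur
  as such a set for some point \<open>p\<close>.\<close>

definition pattern_of ::
  "nat \<Rightarrow> nat \<Rightarrow> (nat \<Rightarrow> coords \<Rightarrow> bool) \<Rightarrow> (nat \<Rightarrow> nat \<Rightarrow> coords) \<Rightarrow> int \<times> int \<Rightarrow> (nat \<times> nat) set" where
  "pattern_of d K P w p = {(i, j). i < d \<and> j < K \<and>
     P i ((w i j)((0, False) := fst p, (0, True) := snd p))}"

text \<open>The two sorts contribute one factor \<open>O(K)\<close> each, so the VC density is at most 2.\<close>

lemma card_patterns_le:
  assumes "\<And>i. i < d \<Longrightarrow> pres (P i)"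
  shows "\<exists>c. \<forall>K w. card (range (pattern_of d K P w)) \<le> c * (K + 1)\<^sup>2"
proof -
  define good where "good i s D C \<longleftrightarrow> 0 < D \<and> finite C \<and> (\<forall>q\<in>C. is_cut s q) \<and>
    (\<forall>e x y. cut_equiv D ((\<lambda>q. q e) ` C) x y \<longrightarrow> P i (e((0, s) := x)) = P i (e((0, s) := y)))" for i s D C
  have "\<exists>D C. i < d \<longrightarrow> good i s D C" for i s
    using pres_cuts[OF assms, of i s 0] unfolding good_def by blast
  then obtain D C where DC: "\<And>i s. i < d \<Longrightarrow> good i s (D i s) (C i s)"
    by metis
  have DC: "0 < D i s" "finite (C i s)" "q \<in> C i s \<Longrightarrow> is_cut s q"
    "cut_equiv (D i s) ((\<lambda>q. q e) ` C i s) x y \<Longrightarrow> P i (e((0, s) := x)) = P i (e((0, s) := y))"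
    if "i < d" for i s q e x y
    using DC[OF that, of s] unfolding good_def by blast+
  \<comment> \<open>A common multiple of all moduli, so that one residue per coordinate serves every
    formula.\<close>
  define E where "E = (\<Prod>i<d. D i False * D i True)"
  have E: "0 < E" "\<And>i s. i < d \<Longrightarrow> D i s dvd E"
  proof -
    show "0 < E"
      unfolding E_def using DC(1) by (intro prod_pos) simp
    fix i s assume "i < d"
    then have "D i False * D i True dvd E"
      unfolding E_def by (intro dvd_prodI) auto
    then show "D i s dvd E"
      by (cases s) (auto elim: dvd_mult_left dvd_mult_right)
  qed
  define F where "F s = (\<Union>i<d. C i s)" for s
  have F: "finite (F s)" for s
    unfolding F_def using DC(2) by auto
  \<comment> \<open>Cuts of one sort ignore the variables of the other. Hence changing one
    coordinate of the point does not move the cuts for the other one.\<close>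
  have cut_other: "q (e((k, s') := x)) = q e" if q: "i < d" "q \<in> C i s" and s: "s \<noteq> s'" for q i s s' e k x
    proof -
    obtain c t where "lin s t" "q = (\<lambda>e. t e div c)"
      using DC(3)[OF q] unfolding is_cut_def by blast
    then show ?thesis
      using lin_upd_other[OF _ s, of t] by simp
  qed
  have "card (range (pattern_of d K P w)) \<le>
      nat E * (d * K * card (F False) + 1) * (nat E * (d * K * card (F True) + 1))" for K w
  proof -
    \<comment> \<open>The values of all cuts at all parameters. Since \<open>F s\<close> depends on
      neither \<open>K\<close> nor \<open>w\<close>, their number is linear in
      \<open>K\<close>.\<close>
    define Q where "Q s = (\<lambda>(ij, q). q (w (fst ij) (snd ij))) ` (({..<d} \<times> {..<K}) \<times> F s)" for s
    have Q: "finite (Q s)" "card (Q s) \<le> d * K * card (F s)" for s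
    proof -
      show "finite (Q s)"
        unfolding Q_def using F by auto
      show "card (Q s) \<le> d * K * card (F s)"
        unfolding Q_def using card_image_le[of "({..<d} \<times> {..<K}) \<times> F s"] F
        by (simp add: card_cartesian_product)
    qed
    define code where "code p = (cut_code E (Q False) (fst p), cut_code E (Q True) (snd p))" for p
    have sub: "range code \<subseteq> ({0..<E} \<times> {..card (Q False)}) \<times> ({0..<E} \<times> {..card (Q True)})"
      unfolding code_def by (intro image_subsetI SigmaI cut_code_in Q(1) E(1))
    then have "card (range code) \<le>
        card (({0..<E} \<times> {..card (Q False)}) \<times> ({0..<E} \<times> {..card (Q True)}))"
      by (intro card_mono) auto
    also have "\<dots> = nat E * (card (Q False) + 1) * (nat E * (card (Q True) + 1))"
      by (simp add: card_cartesian_product)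
    also have "\<dots> \<le> nat E * (d * K * card (F False) + 1) * (nat E * (d * K * card (F True) + 1))"
      using Q(2) by (intro mult_le_mono add_mono order.refl)
    finally have le: "card (range code) \<le> \<dots>" .
    have fin: "finite (range code)"
      using sub by (rule finite_subset) auto
    have "pattern_of d K P w p = pattern_of d K P w p'" if "code p = code p'" for p p'
    proof -
      obtain x y x' y' where p: "p = (x, y)" "p' = (x', y')"
        by fastforce
      have eqv: "cut_equiv E (Q False) x x'" "cut_equiv E (Q True) y y'"
        using that Q(1) by (auto simp: p code_def intro: cut_equiv_if_code_eq)
      have "P i ((w i j)((0, False) := x, (0, True) := y)) =
          P i ((w i j)((0, False) := x', (0, True) := y'))" if ij: "i < d" "j < K" for i j
      proof -
        have sub: "(\<lambda>q. q (w i j)) ` C i s \<subseteq> Q s" for s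
        proof (rule image_subsetI)
          fix q assume "q \<in> C i s"
          then have "((i, j), q) \<in> ({..<d} \<times> {..<K}) \<times> F s"
            using ij by (auto simp: F_def)
          then show "q (w i j) \<in> Q s"
            unfolding Q_def by (rule rev_image_eqI) simp
        qed
        \<comment> \<open>The coordinates are exchanged one at a time; the twist brings the one
          being changed to the outermost update, as \<open>DC(4)\<close> expects.\<close>
        have "P i ((w i j)((0, False) := x, (0, True) := y)) =
            P i ((w i j)((0, True) := y, (0, False) := x))"
          by (subst fun_upd_twist) simp_all
        also have "\<dots> = P i ((w i j)((0, True) := y, (0, False) := x'))"
        proof (rule DC(4)[OF ij(1)])
          have "(\<lambda>q. q ((w i j)((0, True) := y))) ` C i False = (\<lambda>q. q (w i j)) ` C i False"
            by (intro image_cong HOL.refl cut_other[OF ij(1)]) auto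
          then show "cut_equiv (D i False) ((\<lambda>q. q ((w i j)((0, True) := y))) ` C i False) x x'"
            using cut_equiv_mono[OF eqv(1) E(2)[OF ij(1)] sub] by (simp only:)
        qed
        also have "\<dots> = P i ((w i j)((0, False) := x', (0, True) := y))"
          by (subst fun_upd_twist) simp_all
        also have "\<dots> = P i ((w i j)((0, False) := x', (0, True) := y'))"
        proof (rule DC(4)[OF ij(1)])
          have "(\<lambda>q. q ((w i j)((0, False) := x'))) ` C i True = (\<lambda>q. q (w i j)) ` C i True"
            by (intro image_cong HOL.refl cut_other[OF ij(1)]) auto
          then show "cut_equiv (D i True) ((\<lambda>q. q ((w i j)((0, False) := x'))) ` C i True) y y'"
            using cut_equiv_mono[OF eqv(2) E(2)[OF ij(1)] sub] by (simp only:)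
        qed
        finally show ?thesis .
      qed
      then show ?thesis
        by (auto simp: pattern_of_def p simp del: fun_upd_apply)
    qed
    with card_range_le_if_factors[OF fin] le show ?thesis
      by (meson order.trans)
  qed
  moreover have "nat E * (d * K * card (F False) + 1) * (nat E * (d * K * card (F True) + 1)) \<le>
      ((nat E)\<^sup>2 * (d * card (F False) + 1) * (d * card (F True) + 1)) * (K + 1)\<^sup>2" for K
  proof -
    have le: "d * K * m + 1 \<le> (d * m + 1) * (K + 1)" for m
      by (simp add: algebra_simps)
    have "(d * K * card (F False) + 1) * (d * K * card (F True) + 1) \<le>
        ((d * card (F False) + 1) * (K + 1)) * ((d * card (F True) + 1) * (K + 1))"
      by (intro mult_le_mono le)
    from mult_le_mono2[OF this, of "(nat E)\<^sup>2"] show ?thesis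
      by (simp only: power2_eq_square mult_ac)
  qed
  ultimately show ?thesis
    by (meson order.trans)
qed

text \<open>The \<open>K^3\<close> choice functions on three rows have distinct graphs, which
  exceeds the quadratic bound once \<open>K\<close> is large.\<close>

lemma no_large_pattern:
  fixes P :: "nat \<Rightarrow> coords \<Rightarrow> bool"
  assumes "\<And>i. i < 3 \<Longrightarrow> pres (P i)"
  shows "\<exists>K :: nat. \<nexists>w. \<forall>\<eta> :: nat \<Rightarrow> nat. (\<forall>i<3. \<eta> i < K) \<longrightarrow>
    (\<exists>p. pattern_of 3 K P w p = {(i, j). i < 3 \<and> j = \<eta> i})"
proof -
  obtain c where c: "\<And>K w. card (range (pattern_of 3 K P w)) \<le> c * (K + 1)\<^sup>2"
    using card_patterns_le[of 3 P] assms by blast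
  \<comment> \<open>Chosen so that \<open>K \<ge> 1\<close> gives
    \<open>c * (K + 1)^2 \<le> 4 * c * K^2\<close>, and \<open>4 * c < K\<close> makes this less
    than \<open>K^3\<close>.\<close>
  define K where "K = 4 * c + 1"
  have False if w: "\<And>\<eta> :: nat \<Rightarrow> nat. (\<forall>i<3. \<eta> i < K) \<Longrightarrow>
    \<exists>p. pattern_of 3 K P w p = {(i, j). i < 3 \<and> j = \<eta> i}" for w
  proof -
    define \<eta> :: "nat \<times> nat \<times> nat \<Rightarrow> nat \<Rightarrow> nat"
      where "\<eta> = (\<lambda>(k, l, m) i. if i = 0 then k else if i = 1 then l else m)"
    define g where "g t = {(i, j). i < (3::nat) \<and> j = \<eta> t i}" for t
    have "inj g"
    proof (rule injI)
      fix s t assume st: "g s = g t"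
      have "\<eta> s i = \<eta> t i" if "i < 3" for i
      proof -
        have "(i, \<eta> s i) \<in> g t"
          using that by (simp add: st[symmetric]) (simp add: g_def)
        then show ?thesis
          by (simp add: g_def)
      qed
      from this[of 0] this[of 1] this[of 2] show "s = t"
        by (auto simp: \<eta>_def split: prod.splits)
    qed
    have "g ` ({..<K} \<times> {..<K} \<times> {..<K}) \<subseteq> range (pattern_of 3 K P w)"
    proof
      fix s assume "s \<in> g ` ({..<K} \<times> {..<K} \<times> {..<K})"
      then obtain t where t: "t \<in> {..<K} \<times> {..<K} \<times> {..<K}" "s = g t"
        by blast
      then have "\<forall>i<3. \<eta> t i < K"
        by (auto simp: \<eta>_def)
      from w[OF this] show "s \<in> range (pattern_of 3 K P w)"
        by (auto simp: t(2) g_def)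
    qed
    moreover have "finite (range (pattern_of 3 K P w))"
      by (rule finite_subset[of _ "Pow ({..<3} \<times> {..<K})"]) (auto simp: pattern_of_def)
    ultimately have "card ({..<K} \<times> {..<K} \<times> {..<K}) \<le> card (range (pattern_of 3 K P w))"
      using \<open>inj g\<close> by (intro card_inj_on_le[of g]) (auto intro: inj_on_subset)
    also have "\<dots> \<le> c * (K + 1)\<^sup>2"
      by (rule c)
    also have "\<dots> \<le> c * (2 * K)\<^sup>2"
      by (intro mult_le_mono2 power_mono) (auto simp: K_def)
    also have "\<dots> = (4 * c) * (K * K)"
      by (simp add: power2_eq_square)
    also have "\<dots> < K * (K * K)"
      by (intro mult_strict_right_mono) (auto simp: K_def)
    finally show False
      by (simp add: card_cartesian_product)
  qed
  then show ?thesis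
    by blast
qed

section \<open>Formulas over the normal forms\<close>

text \<open>The pair \<open>(n, m)\<close> stands for \<open>x^n y^m\<close>; the parity test is the
  factor \<open>(-1)^n'\<close>, meaningful for negative \<open>n'\<close> too.\<close>

definition kb_group :: "(int \<times> int) monoid" where
  "kb_group = \<lparr>carrier = UNIV,
     mult = (\<lambda>(n, m) (n', m'). (n + n', m' + (if even n' then m else - m))), one = (0, 0)\<rparr>"

definition kb_le :: "int \<times> int \<Rightarrow> int \<times> int \<Rightarrow> bool" where
  "kb_le p q \<longleftrightarrow> fst p < fst q \<or> fst p = fst q \<and> snd p \<le> snd q"

definition kb :: "(fun_sym, rel_sym, int \<times> int) struct" where
  "kb = ordered_group_struct kb_group kb_le"

lemma kb_simps [simp]:
  "univ kb = UNIV"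
  "fun_int kb g [p, q] = (fst p + fst q, snd q + (if even (fst q) then snd p else - snd p))"
  "rel_int kb r [p, q] = kb_le p q"
  by (auto simp: kb_def ordered_group_struct_def kb_group_def split: prod.split)

lemma sig_simps [simp]: "fun_arity ordered_group_sig g = 2" "rel_arity ordered_group_sig r = 2"
  by (simp_all add: ordered_group_sig_def)

lemma is_struct_kb: "is_struct ordered_group_sig kb"
  by (simp add: is_struct_def)

definition of_coords :: "coords \<Rightarrow> nat \<Rightarrow> int \<times> int" where
  "of_coords w k = (w (k, False), w (k, True))"

lemma of_coords_upd:
  "of_coords (w((k, False) := x, (k, True) := y)) = (of_coords w)(k := (x, y))"
  by (auto simp: of_coords_def fun_eq_iff)

lemma length_eq_2: "length xs = 2 \<longleftrightarrow> (\<exists>x y. xs = [x, y])"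
  by (auto simp: numeral_2_eq_2 length_Suc_conv)

text \<open>The exponent of \<open>x\<close> is additive, hence linear without case splits. This
  sharper form for the first coordinate is needed because the parity guard in the second one is a
  divisibility atom, whose argument must be linear.\<close>

lemma eval_trm_kb:
  assumes "wf_trm ordered_group_sig t"
  shows "lin False (\<lambda>w. fst (eval_trm kb (of_coords w) t)) \<and>
    pwlin True (\<lambda>w. snd (eval_trm kb (of_coords w) t))"
  using assms
proof (induction t)
  case (Var k)
  then show ?case
    by (auto simp: of_coords_def intro: lin.var pwlin.lin)
next
  case (Fn g ts)
  then obtain t u where ts: "ts = [t, u]"
    by (auto simp: length_eq_2)
  have IH: "lin False (\<lambda>w. fst (eval_trm kb (of_coords w) t))"
    "pwlin True (\<lambda>w. snd (eval_trm kb (of_coords w) t))"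
    "lin False (\<lambda>w. fst (eval_trm kb (of_coords w) u))"
    "pwlin True (\<lambda>w. snd (eval_trm kb (of_coords w) u))"
    using Fn by (auto simp: ts)
  have "pwlin True (\<lambda>w. snd (eval_trm kb (of_coords w) u) +
      (if 2 dvd fst (eval_trm kb (of_coords w) u) then snd (eval_trm kb (of_coords w) t)
       else - snd (eval_trm kb (of_coords w) t)))"
    using IH by (intro pwlin_add pwlin.if_pres pwlin_uminus pres.dvd) auto
  then show ?case
    using IH by (simp add: ts lin.add)
qed

lemma pwlin_trm:
  assumes "wf_trm ordered_group_sig t"
  shows "pwlin False (\<lambda>w. fst (eval_trm kb (of_coords w) t))"
    "pwlin True (\<lambda>w. snd (eval_trm kb (of_coords w) t))"
  using eval_trm_kb[OF assms] by (auto intro: pwlin.lin)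

text \<open>Equality and the lexicographic order decompose into conditions on single sorts, and a
  quantifier over pairs is eliminated by applying \<open>pres_ex\<close> once in each sort.\<close>

lemma pres_sat_kb:
  assumes "wf_fm ordered_group_sig \<phi>"
  shows "pres (\<lambda>w. sat kb (of_coords w) \<phi>)"
  using assms
proof (induction \<phi>)
  case (Eq t u)
  then have "wf_trm ordered_group_sig t" "wf_trm ordered_group_sig u"
    by auto
  then have "pres (\<lambda>w. fst (eval_trm kb (of_coords w) t) = fst (eval_trm kb (of_coords w) u) \<and>
      snd (eval_trm kb (of_coords w) t) = snd (eval_trm kb (of_coords w) u))"
    by (intro pres.conj pres_equal[OF pwlin_trm(1) pwlin_trm(1)] pres_equal[OF pwlin_trm(2) pwlin_trm(2)])
  then show ?case
    by (simp add: prod_eq_iff)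
next
  case (Rl r ts)
  then obtain t u where ts: "ts = [t, u]"
    by (auto simp: length_eq_2)
  then have "wf_trm ordered_group_sig t" "wf_trm ordered_group_sig u"
    using Rl by auto
  then have "pres (\<lambda>w. fst (eval_trm kb (of_coords w) t) < fst (eval_trm kb (of_coords w) u) \<or>
      fst (eval_trm kb (of_coords w) t) = fst (eval_trm kb (of_coords w) u) \<and>
      snd (eval_trm kb (of_coords w) t) \<le> snd (eval_trm kb (of_coords w) u))"
    by (intro pres_disj pres.conj pres_less[OF pwlin_trm(1) pwlin_trm(1)]
        pres_equal[OF pwlin_trm(1) pwlin_trm(1)] pres_le[OF pwlin_trm(2) pwlin_trm(2)])
  then show ?case
    by (simp add: ts kb_le_def)
next
  case (Exi k \<phi>)
  have "(\<exists>a\<in>univ kb. sat kb ((of_coords w)(k := a)) \<phi>) \<longleftrightarrow>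
      (\<exists>x y. sat kb (of_coords (w((k, False) := x, (k, True) := y))) \<phi>)" for w
    by (simp add: of_coords_upd del: fun_upd_apply)
  moreover have "pres (\<lambda>w. \<exists>x y. sat kb (of_coords (w((k, False) := x, (k, True) := y))) \<phi>)"
    using Exi by (intro pres_ex[where P = "\<lambda>w. \<exists>y. sat kb (of_coords (w((k, True) := y))) \<phi>"] pres_ex) auto
  ultimately show ?case
    by simp
qed (auto intro: pres.intros)

text \<open>The bound \<open>K\<close> is determined by the three formulas alone, so the first
  \<open>K\<close> columns of a pattern in \<open>M\<close> can be carried over to \<open>kb\<close>
  and refuted there.\<close>

lemma no_ict_pattern_3:
  fixes M :: "(fun_sym, rel_sym, 'm) struct" and \<phi> :: "nat \<Rightarrow> (fun_sym, rel_sym) fm"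
  assumes M: "is_struct ordered_group_sig M" "models M (complete_theory ordered_group_sig kb)"
  shows "\<not> ict_pattern ordered_group_sig M 1 \<pi> {..<3} \<phi> a"
proof
  assume pat: "ict_pattern ordered_group_sig M 1 \<pi> {..<3} \<phi> a"
  define P where "P i w = sat kb (of_coords w) (\<phi> i)" for i w
  have "pres (P i)" if "i < 3" for i
    unfolding P_def using pat that by (intro pres_sat_kb) (auto simp: ict_pattern_def)
  then obtain K where K: "\<nexists>w. \<forall>\<eta> :: nat \<Rightarrow> nat. (\<forall>i<3. \<eta> i < K) \<longrightarrow>
    (\<exists>p. pattern_of 3 K P w p = {(i, j). i < 3 \<and> j = \<eta> i})"
    using no_large_pattern by blast
  obtain a' where a': "\<And>\<eta> :: nat \<Rightarrow> nat. (\<forall>i<3. \<eta> i < K) \<Longrightarrow>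
    \<exists>b\<in>univ kb. \<forall>i<3. \<forall>j<K. sat kb (\<lambda>k. if k = 0 then b else a' i j k) (\<phi> i) \<longleftrightarrow> j = \<eta> i"
    using finite_pattern_transfer[OF pat M is_struct_kb, of K] by blast
  define w where "w i j = (\<lambda>(k, s). (if s then snd else fst) (a' i j k))" for i j
  have "of_coords ((w i j)((0, False) := fst p, (0, True) := snd p)) =
      (\<lambda>k. if k = 0 then p else a' i j k)" for i j p
    by (auto simp: fun_eq_iff of_coords_def w_def)
  then have pat_eq: "pattern_of 3 K P w p = {(i, j). i < 3 \<and> j < K \<and>
      sat kb (\<lambda>k. if k = 0 then p else a' i j k) (\<phi> i)}" for p
    by (simp add: pattern_of_def P_def del: fun_upd_apply)
  have "\<exists>p. pattern_of 3 K P w p = {(i, j). i < 3 \<and> j = \<eta> i}" if \<eta>: "\<forall>i<3. \<eta> i < K" for \<eta>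
    using a'[OF \<eta>] \<eta> unfolding pat_eq by fast
  with K show False
    by blast
qed

section \<open>The Klein bottle group\<close>

lemma pres_eq_context: "pres_eq R u v \<Longrightarrow> pres_eq R (w @ u @ w') (w @ v @ w')"
proof (induction rule: pres_eq.induct)
  case (cancel u g s v)
  then show ?case
    using pres_eq.cancel[of R "w @ u" g s "v @ w'"] by simp
next
  case (relation l r u v)
  then show ?case
    using pres_eq.relation[of l r R "w @ u" "v @ w'"] by simp
qed (blast intro: pres_eq.intros)+

lemma pres_eq_append: "pres_eq R u u' \<Longrightarrow> pres_eq R v v' \<Longrightarrow> pres_eq R (u @ v) (u' @ v')"
  using pres_eq_context[of R u u' "[]" v] pres_eq_context[of R v v' u' "[]"]
  by (auto intro: pres_eq.trans)

lemma pres_class_eq_iff: "pres_class R u = pres_class R v \<longleftrightarrow> pres_eq R u v"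
  unfolding pres_class_def by (auto intro: pres_eq.intros)

text \<open>As \<open>pres_eq\<close> is a congruence, the union in the definition of the product is
  a union of equal classes.\<close>

lemma presented_group_simps:
  "carrier (presented_group R) = range (pres_class R)"
  "pres_class R u \<otimes>\<^bsub>presented_group R\<^esub> pres_class R v = pres_class R (u @ v)"
  "\<one>\<^bsub>presented_group R\<^esub> = pres_class R []"
proof -
  have eq: "pres_class R (u' @ v') = pres_class R (u @ v)"
    if "u' \<in> pres_class R u" "v' \<in> pres_class R v" for u' v'
  proof -
    have "pres_eq R u u'" "pres_eq R v v'"
      using that by (simp_all add: pres_class_def)
    then show ?thesis
      unfolding pres_class_eq_iff by (intro pres_eq.sym[OF pres_eq_append])
  qed
  have mem: "u \<in> pres_class R u" "v \<in> pres_class R v"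
    by (auto simp: pres_class_def intro: pres_eq.refl)
  have "(\<Union>u'\<in>pres_class R u. \<Union>v'\<in>pres_class R v. pres_class R (u' @ v')) =
      (\<Union>u'\<in>pres_class R u. \<Union>v'\<in>pres_class R v. pres_class R (u @ v))"
    by (rule SUP_cong[OF HOL.refl], rule SUP_cong[OF HOL.refl], rule eq)
  also have "\<dots> = pres_class R (u @ v)"
    using mem unfolding UN_constant by auto
  finally have "(\<Union>u'\<in>pres_class R u. \<Union>v'\<in>pres_class R v. pres_class R (u' @ v')) = pres_class R (u @ v)" .
  then show "pres_class R u \<otimes>\<^bsub>presented_group R\<^esub> pres_class R v = pres_class R (u @ v)"
    by (simp add: presented_group_def)
qed (simp_all add: presented_group_def)

lemma group_presented_group: "group (presented_group R)"
proof (rule groupI)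
  fix A assume "A \<in> carrier (presented_group R)"
  then obtain u where A: "A = pres_class R u"
    by (auto simp: presented_group_simps)
  have "pres_eq R (rev (map (\<lambda>(g, s). (g, \<not> s)) u) @ u) []"
  proof (induction u)
    case (Cons l u)
    obtain g s where l: "l = (g, s)"
      by fastforce
    have "pres_eq R (rev (map (\<lambda>(g, s). (g, \<not> s)) u) @ [(g, \<not> s), (g, \<not> \<not> s)] @ u)
        (rev (map (\<lambda>(g, s). (g, \<not> s)) u) @ u)"
      by (rule pres_eq.cancel)
    with Cons show ?case
      by (auto simp: l intro: pres_eq.trans)
  qed (simp add: pres_eq.refl)
  then show "\<exists>B\<in>carrier (presented_group R). B \<otimes>\<^bsub>presented_group R\<^esub> A = \<one>\<^bsub>presented_group R\<^esub>"
    by (auto simp: A presented_group_simps pres_class_eq_iff)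
qed (auto simp: presented_group_simps)

text \<open>Each \<open>b\<close> that \<open>a\<close> passes inverts it, so only the parity of the
  exponent survives. The intended case is \<open>a = y\<close>, \<open>b = x\<close>.\<close>

lemma (in group) skew_commute_pow:
  assumes "a \<in> carrier G" "b \<in> carrier G" "a \<otimes> b = b \<otimes> inv a"
  shows "a \<otimes> b [^] (n::nat) = b [^] n \<otimes> (if even n then a else inv a)"
proof (induction n)
  case (Suc n)
  have inv: "inv a \<otimes> b = b \<otimes> a"
  proof -
    have "inv a \<otimes> b = inv a \<otimes> (b \<otimes> inv a) \<otimes> a"
      using assms(1,2) by (simp add: m_assoc)
    also have "\<dots> = b \<otimes> a"
      using assms(1,2) unfolding assms(3)[symmetric] by (simp add: m_assoc[symmetric])
    finally show ?thesis .
  qed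
  have "a \<otimes> b [^] Suc n = (b [^] n \<otimes> (if even n then a else inv a)) \<otimes> b"
    using assms(1,2) Suc by (simp add: m_assoc[symmetric])
  also have "\<dots> = b [^] n \<otimes> (b \<otimes> (if even n then inv a else a))"
    using assms inv by (simp add: m_assoc)
  finally show ?case
    using assms(1,2) by (simp add: m_assoc)
qed (use assms in simp)

text \<open>The relation also holds for the inverse of \<open>a\<close>. This serves negative powers
  of \<open>b\<close> as well as the letter inverse to \<open>y\<close>.\<close>

lemma (in group) skew_flip:
  assumes "a \<in> carrier G" "b \<in> carrier G" "inv b \<otimes> a \<otimes> b = inv a"
  shows "inv b \<otimes> inv a \<otimes> b = inv (inv a)"
proof -
  have "inv (inv b \<otimes> a \<otimes> b) = inv b \<otimes> inv a \<otimes> b"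
    using assms(1,2) by (simp add: inv_mult_group m_assoc)
  then show ?thesis
    by (simp add: assms(3))
qed

lemma (in group) skew_commute_int_pow:
  assumes [simp]: "a \<in> carrier G" "b \<in> carrier G" and rel: "inv b \<otimes> a \<otimes> b = inv a"
  shows "a \<otimes> b [^] (n::int) = b [^] n \<otimes> (if even n then a else inv a)"
proof (cases "n < 0")
  case True
  have "a \<otimes> inv b = inv b \<otimes> inv a"
    using skew_flip[OF assms] inv_solve_right'[of "inv b \<otimes> inv a" a b] by simp
  then have "a \<otimes> inv b [^] nat (- n) = inv b [^] nat (- n) \<otimes> (if even (nat (- n)) then a else inv a)"
    by (intro skew_commute_pow) auto
  moreover have "b [^] n = inv b [^] nat (- n)"
    using True by (simp only: int_pow_def2 if_True nat_pow_inv assms(2))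
  moreover have "even (nat (- n)) \<longleftrightarrow> even n"
    using True by (simp add: even_nat_iff)
  ultimately show ?thesis
    by (simp only:)
next
  case False
  have "a \<otimes> b = b \<otimes> inv a"
    using rel inv_solve_left'[of "inv a" b "a \<otimes> b"] by (simp add: m_assoc)
  then have "a \<otimes> b [^] nat n = b [^] nat n \<otimes> (if even (nat n) then a else inv a)"
    by (intro skew_commute_pow) auto
  moreover have "b [^] n = b [^] nat n"
    using False by (simp only: int_pow_def2 if_False)
  moreover have "even (nat n) \<longleftrightarrow> even n"
    using False by (simp add: even_nat_iff)
  ultimately show ?thesis
    by (simp only:)
qed

section \<open>Normal forms: existence, uniqueness and the isomorphism with pairs\<close>

lemma group_kb_group: "group kb_group"
proof (rule groupI)
  fix p assume "p \<in> carrier kb_group"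
  show "\<exists>q\<in>carrier kb_group. q \<otimes>\<^bsub>kb_group\<^esub> p = \<one>\<^bsub>kb_group\<^esub>"
    by (rule bexI[of _ "(- fst p, if even (fst p) then - snd p else snd p)"])
      (auto simp: kb_group_def split: prod.split)
qed (auto simp: kb_group_def split: prod.split)

lemma kb_int_pow:
  "(1, 0) [^]\<^bsub>kb_group\<^esub> (n::int) = (n, 0)" "(0, 1) [^]\<^bsub>kb_group\<^esub> (n::int) = (0, n)"
proof -
  interpret group kb_group
    by (rule group_kb_group)
  have "(1, 0) [^]\<^bsub>kb_group\<^esub> n = (int n, 0)" "(0, 1) [^]\<^bsub>kb_group\<^esub> n = (0, int n)" for n :: nat
    by (induction n) (auto simp: kb_group_def nat_pow_Suc)
  moreover have "inv\<^bsub>kb_group\<^esub> (k, 0) = (-k, 0)" "inv\<^bsub>kb_group\<^esub> (0, k) = (0, -k)" for k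
    by (rule inv_equality; simp add: kb_group_def)+
  ultimately show "(1, 0) [^]\<^bsub>kb_group\<^esub> (n::int) = (n, 0)" "(0, 1) [^]\<^bsub>kb_group\<^esub> (n::int) = (0, n)"
    by (auto simp: int_pow_def2)
qed

definition kb_letter :: "gen \<times> bool \<Rightarrow> int \<times> int" where
  "kb_letter l = (let c = if snd l then 1 else - 1 in if fst l = X then (c, 0) else (0, c))"

definition kb_word :: "gen word \<Rightarrow> int \<times> int" where
  "kb_word u = foldr (\<lambda>l p. kb_letter l \<otimes>\<^bsub>kb_group\<^esub> p) u \<one>\<^bsub>kb_group\<^esub>"

lemma kb_word_append: "kb_word (u @ v) = kb_word u \<otimes>\<^bsub>kb_group\<^esub> kb_word v"
proof -
  interpret group kb_group
    by (rule group_kb_group)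
  have [simp]: "p \<in> carrier kb_group" for p
    by (simp add: kb_group_def)
  show ?thesis
    by (induction u) (simp_all add: kb_word_def m_assoc)
qed

text \<open>The defining relation holds among the pairs, so the evaluation of words descends to the
  presented group; this makes \<open>kb_of\<close> independent of the chosen representative.\<close>

lemma kb_word_cong: "pres_eq klein_relations u v \<Longrightarrow> kb_word u = kb_word v"
proof (induction rule: pres_eq.induct)
  case (cancel u g s v)
  interpret group kb_group
    by (rule group_kb_group)
  have [simp]: "p \<in> carrier kb_group" for p
    by (simp add: kb_group_def)
  have "kb_word [(g, s), (g, \<not> s)] = \<one>\<^bsub>kb_group\<^esub>"
    by (cases s) (auto simp: kb_word_def kb_letter_def kb_group_def)
  then show ?case
    by (simp only: kb_word_append) simp
next
  case (relation l r u v)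
  then have "kb_word l = kb_word r"
    by (auto simp: klein_relations_def kb_word_def kb_letter_def kb_group_def)
  then show ?case
    by (simp add: kb_word_append)
qed auto

definition kb_of :: "gen word set \<Rightarrow> int \<times> int" where
  "kb_of A = kb_word (SOME u. A = pres_class klein_relations u)"

lemma kb_of_pres_class: "kb_of (pres_class klein_relations u) = kb_word u"
  unfolding kb_of_def by (rule someI2[of _ u]) (auto simp: pres_class_eq_iff dest: kb_word_cong)

lemma group_klein_group: "group klein_group"
  unfolding klein_group_def by (rule group_presented_group)

lemma kb_of_hom: "kb_of \<in> hom klein_group kb_group"
  by (auto simp: hom_def klein_group_def presented_group_simps kb_of_pres_class kb_word_append)
    (simp add: kb_group_def)

lemma klein_generators_carrier: "klein_x \<in> carrier klein_group" "klein_y \<in> carrier klein_group"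
  by (auto simp: klein_x_def klein_y_def klein_group_def presented_group_simps)

text \<open>The exponents can be read off from the element, which is the uniqueness of normal
  forms.\<close>

lemma kb_of_klein_nf: "kb_of (klein_nf n m) = (n, m)"
proof -
  interpret group_hom klein_group kb_group kb_of
    using kb_of_hom group_klein_group group_kb_group by (simp add: group_hom_def group_hom_axioms_def)
  have "kb_of klein_x = (1, 0)" "kb_of klein_y = (0, 1)"
    by (auto simp: klein_x_def klein_y_def kb_of_pres_class kb_word_def kb_letter_def kb_group_def)
  then have "kb_of (klein_nf n m) = (n, 0) \<otimes>\<^bsub>kb_group\<^esub> (0, m)"
    using klein_generators_carrier by (simp add: klein_nf_def hom_int_pow kb_int_pow)
  then show ?thesis
    by (simp add: kb_group_def)
qed

text \<open>Existence of normal forms, by prepending letters: a power of \<open>x\<close> adds to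
  the first exponent, while a power of \<open>y\<close> has to pass \<open>x^n\<close> and picks up
  the sign of its parity.\<close>

lemma klein_nf_surj:
  assumes "A \<in> carrier klein_group"
  shows "\<exists>n m. A = klein_nf n m"
proof -
  interpret group klein_group
    by (rule group_klein_group)
  note [simp] = klein_generators_carrier
  let ?c = "pres_class klein_relations"
  have mult: "?c u \<otimes>\<^bsub>klein_group\<^esub> ?c v = ?c (u @ v)" and one: "\<one>\<^bsub>klein_group\<^esub> = ?c []" for u v
    by (simp_all add: klein_group_def presented_group_simps)
  have car: "?c u \<in> carrier klein_group" for u
    by (simp add: klein_group_def presented_group_simps)
  have inv_letter: "inv\<^bsub>klein_group\<^esub> ?c [(g, True)] = ?c [(g, False)]" for g
    using pres_eq.cancel[of klein_relations "[]" g False "[]"]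
    by (intro inv_equality) (auto simp: mult one car pres_class_eq_iff)
  have klein_rel: "([(X, False), (Y, True), (X, True)], [(Y, False)]) \<in> klein_relations"
    by (simp add: klein_relations_def)
  have rel: "inv\<^bsub>klein_group\<^esub> klein_x \<otimes>\<^bsub>klein_group\<^esub> klein_y \<otimes>\<^bsub>klein_group\<^esub> klein_x = inv\<^bsub>klein_group\<^esub> klein_y"
    using pres_eq.relation[OF klein_rel, of "[]" "[]"]
    by (simp add: klein_x_def klein_y_def inv_letter mult pres_class_eq_iff)
  note y_pow = skew_commute_int_pow[OF klein_generators_carrier(2,1) rel]
    and iy_pow = skew_commute_int_pow[OF _ _ skew_flip[OF klein_generators_carrier(2,1) rel]]
  have pow1: "klein_x [^]\<^bsub>klein_group\<^esub> (- 1::int) = inv\<^bsub>klein_group\<^esub> klein_x"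
    "klein_y [^]\<^bsub>klein_group\<^esub> (- 1::int) = inv\<^bsub>klein_group\<^esub> klein_y"
    by (simp_all add: int_pow_neg)
  obtain u where "A = ?c u"
    using assms by (auto simp: klein_group_def presented_group_simps)
  moreover have "\<exists>n m. ?c u = klein_nf n m"
  proof (induction u)
    case Nil
    show ?case
      by (intro exI[of _ 0]) (simp add: klein_nf_def one[symmetric])
  next
    case (Cons l u)
    then obtain n m where u: "?c u = klein_nf n m"
      by blast
    obtain g s where l: "l = (g, s)"
      by fastforce
    define c :: int where "c = (if s then 1 else - 1)"
    have "?c (l # u) = ?c [l] \<otimes>\<^bsub>klein_group\<^esub> klein_nf n m"
      using mult[of "[l]" u] by (simp add: u)
    also have "\<dots> = (case g of X \<Rightarrow> klein_nf (c + n) m | Y \<Rightarrow> klein_nf n ((if even n then c else - c) + m))"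
    proof (cases g)
      case X
      then have "?c [l] = klein_x [^]\<^bsub>klein_group\<^esub> c"
        using inv_letter[of X] by (cases s) (simp_all add: l c_def pow1 klein_x_def[symmetric])
      then show ?thesis
        using X by (simp add: klein_nf_def int_pow_mult m_assoc)
    next
      case Y
      then have cl: "?c [l] = (if s then klein_y else inv\<^bsub>klein_group\<^esub> klein_y)"
        using inv_letter[of Y] by (simp add: l klein_y_def)
      let ?e = "if even n then c else - c"
      have "?c [l] \<otimes>\<^bsub>klein_group\<^esub> klein_x [^]\<^bsub>klein_group\<^esub> n =
          klein_x [^]\<^bsub>klein_group\<^esub> n \<otimes>\<^bsub>klein_group\<^esub> klein_y [^]\<^bsub>klein_group\<^esub> ?e"
        by (cases s; cases "even n") (simp_all add: cl c_def pow1 y_pow iy_pow)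
      then have "?c [l] \<otimes>\<^bsub>klein_group\<^esub> klein_nf n m = klein_x [^]\<^bsub>klein_group\<^esub> n \<otimes>\<^bsub>klein_group\<^esub>
          klein_y [^]\<^bsub>klein_group\<^esub> ?e \<otimes>\<^bsub>klein_group\<^esub> klein_y [^]\<^bsub>klein_group\<^esub> m"
        by (simp only: klein_nf_def m_assoc[symmetric] car int_pow_closed klein_generators_carrier)
      also have "\<dots> = klein_nf n (?e + m)"
        by (simp only: klein_nf_def m_assoc int_pow_mult int_pow_closed klein_generators_carrier)
      finally show ?thesis
        using Y by simp
    qed
    finally show ?case
      by (cases g) auto
  qed
  ultimately show ?thesis
    by blast
qed

lemma klein_struct_iso:
  "struct_iso ordered_group_sig (ordered_group_struct klein_group klein_le) kb kb_of"
proof -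
  have inj: "inj_on kb_of (carrier klein_group)"
    by (rule inj_onI) (metis klein_nf_surj kb_of_klein_nf prod.inject)
  have nf_carrier: "klein_nf n m \<in> carrier klein_group" for n m
  proof -
    interpret group klein_group
      by (rule group_klein_group)
    show ?thesis
      by (simp add: klein_nf_def klein_generators_carrier)
  qed
  have "p \<in> kb_of ` carrier klein_group" for p
    using nf_carrier kb_of_klein_nf[of "fst p" "snd p"] by (metis image_eqI prod.collapse)
  then have bij: "bij_betw kb_of (carrier klein_group) UNIV"
    using inj by (auto simp: bij_betw_def)
  have mult: "kb_of (a \<otimes>\<^bsub>klein_group\<^esub> b) = kb_of a \<otimes>\<^bsub>kb_group\<^esub> kb_of b"
    if "a \<in> carrier klein_group" "b \<in> carrier klein_group" for a b
    using that kb_of_hom by (simp add: hom_def)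
  have le: "klein_le a b \<longleftrightarrow> kb_le (kb_of a) (kb_of b)"
    if carrier: "a \<in> carrier klein_group" "b \<in> carrier klein_group" for a b
  proof -
    obtain n m n' m' where ab: "a = klein_nf n m" "b = klein_nf n' m'"
      using klein_nf_surj[OF carrier(1)] klein_nf_surj[OF carrier(2)] by blast
    have nf_eq: "klein_nf k l = klein_nf k' l' \<longleftrightarrow> k = k' \<and> l = l'" for k l k' l'
      by (metis kb_of_klein_nf prod.inject)
    show ?thesis
      by (auto simp: ab klein_le_def nf_eq kb_le_def kb_of_klein_nf)
  qed
  show ?thesis
    using bij mult le by (auto simp: struct_iso_def kb_def ordered_group_struct_def length_eq_2)
      (simp add: kb_group_def)
qed

lemma complete_theory_klein:
  "complete_theory ordered_group_sig (ordered_group_struct klein_group klein_le) =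
   complete_theory ordered_group_sig kb"
proof (rule complete_theory_iso[OF klein_struct_iso, symmetric])
  interpret group klein_group
    by (rule group_klein_group)
  show "is_struct ordered_group_sig (ordered_group_struct klein_group klein_le)"
    by (auto simp: is_struct_def ordered_group_struct_def length_eq_2)
qed

section \<open>Dp-rank\<close>

text \<open>For \<open>g = x^(2k) y^l\<close> we have \<open>g x^(-1) g x = x^(4k)\<close> and \<open>x g = g x y^(2l)\<close>, so the two formulas
  recover \<open>k\<close> and \<open>l\<close> independently of each other.\<close>

definition rank_fm :: "nat \<Rightarrow> (fun_sym, rel_sym) fm" where
  "rank_fm i = (if i = 0
     then Eq (Fn Mult [Fn Mult [Fn Mult [Var 0, Var 1], Var 0], Var 2]) (Var 3)
     else Eq (Fn Mult [Var 2, Var 0]) (Fn Mult [Fn Mult [Var 0, Var 2], Var 3]))"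

text \<open>Variables 1 and 2 hold the inverse of \<open>x\<close> and \<open>x\<close> themselves,
  because the language has multiplication as its only function symbol; variable 3 alone varies with
  the column.\<close>

definition rank_par :: "nat \<Rightarrow> nat \<Rightarrow> nat \<Rightarrow> int \<times> int" where
  "rank_par i j k = (if k = 1 then (- 1, 0) else if k = 2 then (1, 0)
     else if i = 0 then (4 * int j, 0) else (0, 2 * int j))"

text \<open>With an even exponent of \<open>x\<close>, the exponents of \<open>y\<close> in
  \<open>g x^(-1) g\<close> cancel, so the first condition does not see \<open>\<eta> 1\<close>; the
  second compares \<open>y\<close>-exponents only and does not see \<open>\<eta> 0\<close>.\<close>

lemma sat_rank_fm:
  assumes "i < 2"
  shows "sat kb (\<lambda>k. if k = 0 then (2 * int (\<eta> 0), int (\<eta> 1)) else rank_par i j k) (rank_fm i) \<longleftrightarrow> j = \<eta> i"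
  using assms by (auto simp: rank_fm_def rank_par_def less_2_cases_iff)

text \<open>Every choice \<eta> is realized by a point of the structure itself, so the identity is
  the elementary embedding asked for. The countable \<open>kb\<close> only has to be copied into the
  given infinite type.\<close>

lemma has_ict_pattern_2:
  "has_ict_pattern_of_depth TYPE('m::infinite) ordered_group_sig (complete_theory ordered_group_sig kb)
     1 {Eq (Var 0) (Var 0)} (card_of {..<2::nat})"
proof -
  obtain f0 :: "nat \<Rightarrow> 'm" where f0: "inj f0"
    using infinite_countable_subset[OF infinite_UNIV] by blast
  define f where "f p = f0 (prod_encode (int_encode (fst p), int_encode (snd p)))" for p
  have "inj f"
    by (rule injI) (auto simp: f_def inj_eq[OF f0] inj_eq[OF inj_int_encode] prod_eq_iff)
  then have f: "inj_on f (univ kb)"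
    by simp
  obtain M :: "(fun_sym, rel_sym, 'm) struct" where
    M: "struct_iso ordered_group_sig kb M f" "is_struct ordered_group_sig M"
    using struct_iso_image[OF f is_struct_kb] by blast
  have f_univ: "f p \<in> univ M" for p
    using M(1) by (auto simp: struct_iso_def bij_betw_def)
  define a where "a i j k = f (rank_par i j k)" for i j k
  have a_univ: "range (a i j) \<subseteq> univ M" for i j
    unfolding a_def using f_univ by blast
  have wf: "wf_fm ordered_group_sig (rank_fm i)" for i
    by (simp add: rank_fm_def)
  have "consistent ordered_group_sig M 1
        ({(\<psi>, c) | \<psi> c. \<psi> \<in> {Eq (Var 0) (Var 0)} \<and> range c \<subseteq> univ M} \<union>
         {(rank_fm i, a i (\<eta> i)) | i. i \<in> {..<2}} \<union>
         {(Neg (rank_fm i), a i j) | i j. i \<in> {..<2} \<and> j \<noteq> \<eta> i})" for \<eta>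
  proof -
    let ?p = "(2 * int (\<eta> 0), int (\<eta> 1))"
    have "sat M (\<lambda>k. if k < 1 then f ?p else id (a i j k)) (rank_fm i) \<longleftrightarrow> j = \<eta> i"
      if "i < 2" for i j
    proof -
      have "(\<lambda>k. if k < 1 then f ?p else id (a i j k)) =
          f \<circ> (\<lambda>k. if k = 0 then ?p else rank_par i j k)"
        by (auto simp: fun_eq_iff a_def)
      then show ?thesis
        using sat_iso[OF M(1) is_struct_kb wf] sat_rank_fm[OF that] by simp
    qed
    then show ?thesis
      unfolding consistent_def using M(2) f_univ elementary_embedding_id
      by (intro exI[of _ M] exI[of _ id] exI[of _ "\<lambda>_. f ?p"]) auto
  qed
  then have "ict_pattern ordered_group_sig M 1 {Eq (Var 0) (Var 0)} {..<2} rank_fm a"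
    using wf a_univ unfolding ict_pattern_def by blast
  moreover have "models M (complete_theory ordered_group_sig kb)"
    using complete_theory_iso[OF M(1) is_struct_kb] models_complete_theory by metis
  ultimately show ?thesis
    unfolding has_ict_pattern_of_depth_def Field_card_of using M(2) by blast
qed

text \<open>Three indices from the field of \<nu> would already give a pattern of depth 3, so the
  field is finite with at most two elements, whatever cardinal \<nu> is.\<close>

lemma ict_pattern_depth_le_2:
  fixes \<nu> :: "'j rel"
  assumes "Card_order \<nu>"
    and "has_ict_pattern_of_depth TYPE('m) ordered_group_sig (complete_theory ordered_group_sig kb) 1 \<pi> \<nu>"
  shows "(\<nu>, card_of {..<2::nat}) \<in> ordLeq"
proof -
  obtain M :: "(fun_sym, rel_sym, 'm) struct" and \<phi> a where
    M: "is_struct ordered_group_sig M" "models M (complete_theory ordered_group_sig kb)"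
    and pat: "ict_pattern ordered_group_sig M 1 \<pi> (Field \<nu>) \<phi> a"
    using assms(2) unfolding has_ict_pattern_of_depth_def by blast
  have no3: "\<nexists>J. J \<subseteq> Field \<nu> \<and> finite J \<and> card J = 3"
  proof
    assume "\<exists>J. J \<subseteq> Field \<nu> \<and> finite J \<and> card J = 3"
    then obtain J where J: "J \<subseteq> Field \<nu>" "finite J" "card J = 3"
      by blast
    obtain g where "bij_betw g {0..<card J} J"
      using ex_bij_betw_nat_finite[OF J(2)] by blast
    then have "inj_on g {..<3}" "g ` {..<3} \<subseteq> Field \<nu>"
      using J by (auto simp: bij_betw_def lessThan_atLeast0)
    from ict_pattern_reindex[OF pat this] show False
      using no_ict_pattern_3[OF M] by blast
  qed
  have fin: "finite (Field \<nu>)"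
    using no3 infinite_arbitrarily_large by blast
  have "card (Field \<nu>) \<le> 2"
  proof (rule ccontr)
    assume "\<not> card (Field \<nu>) \<le> 2"
    then show False
      using obtain_subset_with_card_n[of 3 "Field \<nu>"] no3 by (metis Suc_leI eval_nat_numeral(3) not_le)
  qed
  then have "(card_of (Field \<nu>), card_of {..<2::nat}) \<in> ordLeq"
    using fin inj_on_iff_card_le[of "Field \<nu>" "{..<2::nat}"] card_of_ordLeq[of "Field \<nu>" "{..<2::nat}"] by simp
  then show ?thesis
    using card_of_Field_ordIso[OF assms(1)] ordIso_ordLeq_trans ordIso_symmetric by blast
qed

theorem proposition1p1:
  shows "structure_has_dp_rank TYPE('m::infinite) TYPE('j) ordered_group_sig
    (ordered_group_struct klein_group klein_le) (card_of {..<2::nat})"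
  unfolding structure_has_dp_rank_def theory_has_dp_rank_def has_dp_rank_def complete_theory_klein
  using has_ict_pattern_2 ict_pattern_depth_le_2 by (auto intro: card_of_Card_order)

end
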